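(* Let $d\ge 1$, let $R=\mathbb{Z}[u_1^{\pm1},\dots,u_d^{\pm1}]$, let $A$ be a $k\times n$ matrix over $R$ of rank $k$, and let $M_A=R^k/AR^n$. Let $B_j$, $j=1,\dots,\binom{n}{k}$, be the $k\times k$ submatrices of $A$. Then the $\mathbb{Z}^d$-action $\alpha^{M_A}$ on $X_{M_A}=\widehat{M_A}$ is expansive if and only if $$(\mathbb{S}^1)^d\cap\left(\bigcap_{j=1,\dots,\binom{n}{k}}V(\det(B_j))\right)=\emptyset .$$
   Context: For an $R$-module $M$ (with the discrete topology), $X_M=\widehat{M}$ is the compact abelian Pontryagin dual group of $M$, and $\alpha^M$ is the $\mathbb{Z}^d$-action by automorphisms of $X_M$ in which, for $\mathbf{n}=(n_1,\dots,n_d)\in\mathbb{Z}^d$, $\alpha^M_{\mathbf n}$ is the automorphism dual to the automorphism $a\mapsto u^{\mathbf n}a$ of $M$, with $u^{\mathbf n}=u_1^{n_1}\cdots u_d^{n_d}$. $\mathbb{S}^1=\{z\in\mathbb{C}:|z|=1\}$. For $f\in R$, $V(f)$ is the set of complex zeros of $f$ in $\mathbb{C}^d$ (only points with all coordinates of modulus one matter here, at which every Laurent polynomial can be evaluated). A $\mathbb{Z}^d$-action $\alpha$ by automorphisms of a compact abelian group $X$ is expansive if there is a neighbourhood $N$ of the identity $0\in X$ with $\bigcap_{\mathbf n\in\mathbb{Z}^d}\alpha_{\mathbf n}(N)=\{0\}$. *)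

theory Defs
  imports
    "HOL-Analysis.Function_Topology"
    "HOL-Analysis.Product_Topology"
    "HOL-Analysis.T1_Spaces"
    "HOL-Analysis.Topology_Euclidean_Space"
    "HOL-Library.Poly_Mapping"
    "HOL-Algebra.AbelCoset"
    "HOL-Computational_Algebra.Normalized_Fraction"
    "Jordan_Normal_Form.DL_Rank"
    "Jordan_Normal_Form.DL_Submatrix"
begin

section \<open>Laurent polynomials\<close>

type_synonym 'd zvec = "'d \<Rightarrow>\<^sub>0 int"
type_synonym 'd laurent = "'d zvec \<Rightarrow>\<^sub>0 int"

text \<open>
  As \<^typ>\<open>'d\<close> is finite, \<^typ>\<open>'d zvec\<close> is the free abelian group on \<^typ>\<open>'d\<close>,
  that is \<open>\<int>\<^sup>d\<close> with \<open>d = CARD('d) \<ge> 1\<close>, and \<^typ>\<open>'d laurent\<close>, whose product is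
  the convolution product, is its integral group ring
  \<open>\<int>[u\<^sub>1\<^sup>\<plusminus>\<^sup>1, \<dots>, u\<^sub>d\<^sup>\<plusminus>\<^sup>1]\<close>.
  A linear order on \<^typ>\<open>'d\<close> is required only by the library's instance making this ring
  an integral domain.
\<close>

definition umonom :: "'d zvec \<Rightarrow> 'd laurent"  (* u^n *)
  where "umonom n = Poly_Mapping.single n 1"

lemma umonom_add: "umonom (m + n) = umonom m * umonom n"
  by (simp add: umonom_def mult_single)

lemma umonom_0: "umonom 0 = 1"
  by (simp add: umonom_def)

definition laurent_eval :: "'d::finite laurent \<Rightarrow> ('d \<Rightarrow> complex) \<Rightarrow> complex"
  where "laurent_eval f z =
    (\<Sum>m \<in> Poly_Mapping.keys f. of_int (Poly_Mapping.lookup f m) * (\<Prod>i\<in>UNIV. z i powi Poly_Mapping.lookup m i))"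

text \<open>
  A Laurent polynomial has no value at a point with a vanishing coordinate (where \<^term>\<open>(powi)\<close>
  would silently compute with \<^prop>\<open>inverse 0 = (0::complex)\<close>), so such points are excluded.
\<close>

definition zero_locus :: "'d::finite laurent \<Rightarrow> ('d \<Rightarrow> complex) set"
  where "zero_locus f = {z. (\<forall>i. z i \<noteq> 0) \<and> laurent_eval f z = 0}"

definition unit_torus :: "('d \<Rightarrow> complex) set"
  where "unit_torus = {z. \<forall>i. cmod (z i) = 1}"


section \<open>Quotient modules\<close>

text \<open>
  The fields \<^const>\<open>monoid.mult\<close> and \<^const>\<open>monoid.one\<close> of a module record carry no meaning.
\<close>

definition quot_module :: "('r, 'm, 'b) module_scheme \<Rightarrow> 'm set \<Rightarrow> ('r, 'm set) module"
  where "quot_module M N =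
    \<lparr>carrier = a_rcosets\<^bsub>M\<^esub> N, monoid.mult = undefined, one = undefined, zero = N, add = set_add M,
     smult = (\<lambda>r C. \<Union>x\<in>C. N +>\<^bsub>M\<^esub> (r \<odot>\<^bsub>M\<^esub> x))\<rparr>"

definition mat_image :: "'a::comm_ring_1 mat \<Rightarrow> 'a vec set"
  where "mat_image A = (\<lambda>x. A *\<^sub>v x) ` carrier_vec (dim_col A)"

definition coker_module :: "'a::comm_ring_1 mat \<Rightarrow> ('a, 'a vec set) module"
  where "coker_module A = quot_module (module_vec TYPE('a) (dim_row A)) (mat_image A)"

lemma submodule_abelian_subgroup:
  assumes "module R M" "Module.submodule N R M"
  shows "abelian_subgroup N M"
  using assms
  by (intro abelian_subgroupI3 additive_subgroup.intro) (auto simp: Module.submodule_def Module.module_def)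

lemma a_r_coset_iff: "y \<in> N +>\<^bsub>M\<^esub> x \<longleftrightarrow> (\<exists>h\<in>N. y = h \<oplus>\<^bsub>M\<^esub> x)"
  by (auto simp: a_r_coset_defs)

lemma quot_module_smult:
  assumes "module R M" "Module.submodule N R M" "r \<in> carrier R" "x \<in> carrier M"
  shows "r \<odot>\<^bsub>quot_module M N\<^esub> (N +>\<^bsub>M\<^esub> x) = N +>\<^bsub>M\<^esub> (r \<odot>\<^bsub>M\<^esub> x)"
proof -
  interpret module R M by fact
  interpret abelian_subgroup N M using submodule_abelian_subgroup assms by blast
  have *: "N +>\<^bsub>M\<^esub> (r \<odot>\<^bsub>M\<^esub> y) = N +>\<^bsub>M\<^esub> (r \<odot>\<^bsub>M\<^esub> x)" if "y \<in> N +>\<^bsub>M\<^esub> x" for y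
  proof -
    from that obtain h where h: "h \<in> N" "y = h \<oplus>\<^bsub>M\<^esub> x" unfolding a_r_coset_iff ..
    have hM: "h \<in> carrier M" using h a_subset by blast
    have "r \<odot>\<^bsub>M\<^esub> h \<in> N" using assms h by (auto simp: Module.submodule_def submodule_axioms_def)
    moreover have "r \<odot>\<^bsub>M\<^esub> y = r \<odot>\<^bsub>M\<^esub> h \<oplus>\<^bsub>M\<^esub> r \<odot>\<^bsub>M\<^esub> x"
      using h hM assms by (simp add: smult_r_distr)
    ultimately have "r \<odot>\<^bsub>M\<^esub> y \<in> N +>\<^bsub>M\<^esub> (r \<odot>\<^bsub>M\<^esub> x)" unfolding a_r_coset_iff by (intro bexI)
    thus ?thesis
      by (rule a_repr_independence'[symmetric]) (simp add: assms)
  qed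
  have "x \<in> N +>\<^bsub>M\<^esub> x" using assms a_rcos_self by blast
  hence "(\<Union>y\<in>N +>\<^bsub>M\<^esub> x. N +>\<^bsub>M\<^esub> (r \<odot>\<^bsub>M\<^esub> y)) = N +>\<^bsub>M\<^esub> (r \<odot>\<^bsub>M\<^esub> x)"
    using * by blast
  thus ?thesis by (simp add: quot_module_def)
qed

lemma quot_module_simps:
  "carrier (quot_module M N) = a_rcosets\<^bsub>M\<^esub> N" "zero (quot_module M N) = N"
  "add (quot_module M N) = set_add M"
  by (auto simp: quot_module_def)

lemma module_quot_module:
  assumes "module R M" "Module.submodule N R M"
  shows "module R (quot_module M N)"
proof -
  interpret module R M by fact
  interpret S: abelian_subgroup N M using submodule_abelian_subgroup assms by blast
  note sm = quot_module_smult[OF assms]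
  have ca: "\<exists>x\<in>carrier M. C = N +>\<^bsub>M\<^esub> x" if "C \<in> carrier (quot_module M N)" for C
    using that by (auto simp: quot_module_simps A_RCOSETS_def')
  have ci: "N +>\<^bsub>M\<^esub> x \<in> carrier (quot_module M N)" if "x \<in> carrier M" for x
    using that by (auto simp: quot_module_simps A_RCOSETS_def')
  have ad: "(N +>\<^bsub>M\<^esub> x) \<oplus>\<^bsub>quot_module M N\<^esub> (N +>\<^bsub>M\<^esub> y) = N +>\<^bsub>M\<^esub> (x \<oplus>\<^bsub>M\<^esub> y)"
    if "x \<in> carrier M" "y \<in> carrier M" for x y
    using that by (simp add: quot_module_simps S.a_rcos_sum)
  have z: "\<zero>\<^bsub>quot_module M N\<^esub> = N +>\<^bsub>M\<^esub> \<zero>\<^bsub>M\<^esub>" 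
    using S.a_subset by (simp add: quot_module_simps)
  show ?thesis
  proof (rule moduleI)
    show "cring R" by (rule R.is_cring)
    show "abelian_group (quot_module M N)"
    proof (rule abelian_groupI)
      fix C assume "C \<in> carrier (quot_module M N)"
      then obtain x where x: "x \<in> carrier M" "C = N +>\<^bsub>M\<^esub> x" using ca by blast
      show "\<exists>y\<in>carrier (quot_module M N). y \<oplus>\<^bsub>quot_module M N\<^esub> C = \<zero>\<^bsub>quot_module M N\<^esub>"
        using x ci[of "\<ominus>\<^bsub>M\<^esub> x"] ad[of "\<ominus>\<^bsub>M\<^esub> x" x] z
        by (intro bexI[of _ "N +>\<^bsub>M\<^esub> (\<ominus>\<^bsub>M\<^esub> x)"]) (auto simp: M.l_neg)
      show "\<zero>\<^bsub>quot_module M N\<^esub> \<oplus>\<^bsub>quot_module M N\<^esub> C = C"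
        using x by (simp add: z ad)
    next
      fix C D assume "C \<in> carrier (quot_module M N)" "D \<in> carrier (quot_module M N)"
      then obtain x y where xy: "x \<in> carrier M" "C = N +>\<^bsub>M\<^esub> x" "y \<in> carrier M" "D = N +>\<^bsub>M\<^esub> y"
        using ca by meson
      show "C \<oplus>\<^bsub>quot_module M N\<^esub> D \<in> carrier (quot_module M N)" using xy by (simp add: ad ci)
      show "C \<oplus>\<^bsub>quot_module M N\<^esub> D = D \<oplus>\<^bsub>quot_module M N\<^esub> C"
        using xy by (simp add: ad M.a_comm[of x y])
      fix E assume "E \<in> carrier (quot_module M N)"
      then obtain w where "w \<in> carrier M" "E = N +>\<^bsub>M\<^esub> w" using ca by blast
      thus "C \<oplus>\<^bsub>quot_module M N\<^esub> D \<oplus>\<^bsub>quot_module M N\<^esub> E = C \<oplus>\<^bsub>quot_module M N\<^esub> (D \<oplus>\<^bsub>quot_module M N\<^esub> E)"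
        using xy by (simp add: ad M.a_assoc)
    qed (simp add: z ci)
  next
    fix r C assume r: "r \<in> carrier R" and "C \<in> carrier (quot_module M N)"
    then obtain x where x: "x \<in> carrier M" "C = N +>\<^bsub>M\<^esub> x" using ca by blast
    show "r \<odot>\<^bsub>quot_module M N\<^esub> C \<in> carrier (quot_module M N)" using r x by (simp add: sm ci)
    {
      fix s assume s: "s \<in> carrier R"
      show "(r \<oplus>\<^bsub>R\<^esub> s) \<odot>\<^bsub>quot_module M N\<^esub> C = r \<odot>\<^bsub>quot_module M N\<^esub> C \<oplus>\<^bsub>quot_module M N\<^esub> s \<odot>\<^bsub>quot_module M N\<^esub> C"
        using r s x by (simp add: sm ad smult_l_distr)
      show "(r \<otimes>\<^bsub>R\<^esub> s) \<odot>\<^bsub>quot_module M N\<^esub> C = r \<odot>\<^bsub>quot_module M N\<^esub> (s \<odot>\<^bsub>quot_module M N\<^esub> C)"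
        using r s x by (simp add: sm smult_assoc1)
    }
    fix D assume "D \<in> carrier (quot_module M N)"
    then obtain y where y: "y \<in> carrier M" "D = N +>\<^bsub>M\<^esub> y" using ca by blast
    show "r \<odot>\<^bsub>quot_module M N\<^esub> (C \<oplus>\<^bsub>quot_module M N\<^esub> D) = r \<odot>\<^bsub>quot_module M N\<^esub> C \<oplus>\<^bsub>quot_module M N\<^esub> r \<odot>\<^bsub>quot_module M N\<^esub> D"
      using r x y by (simp add: sm ad smult_r_distr)
  next
    fix C assume "C \<in> carrier (quot_module M N)"
    then obtain x where "x \<in> carrier M" "C = N +>\<^bsub>M\<^esub> x" using ca by blast
    thus "\<one>\<^bsub>R\<^esub> \<odot>\<^bsub>quot_module M N\<^esub> C = C" by (simp add: sm)
  qed
qed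

lemma module_coker_module:
  fixes A :: "'a::comm_ring_1 mat"
  shows "module class_ring (coker_module A)"
proof -
  let ?V = "module_vec TYPE('a) (dim_row A)"
  interpret vec_module "TYPE('a)" "dim_row A" .
  have "module class_ring ?V" by unfold_locales
  moreover have "Module.submodule (mat_image A) class_ring ?V"
  proof (rule Module.module.submoduleI[OF calculation])
    show "mat_image A \<subseteq> carrier ?V"
      by (auto simp: mat_image_def module_vec_simps intro!: mult_mat_vec_carrier[of A _ "dim_col A"])
  next
    show "\<zero>\<^bsub>?V\<^esub> \<in> mat_image A"
      by (auto simp: mat_image_def module_vec_simps intro!: image_eqI[of _ _ "0\<^sub>v (dim_col A)"])
  next
    fix a b assume "a \<in> mat_image A" "b \<in> mat_image A"
    thus "a \<oplus>\<^bsub>?V\<^esub> b \<in> mat_image A" 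
     unfolding mat_image_def module_vec_simps
     using mult_add_distrib_mat_vec[of A "dim_row A" "dim_col A", symmetric] by force
  next
    fix r a assume "a \<in> mat_image A" 
    thus "r \<odot>\<^bsub>?V\<^esub> a \<in> mat_image A"
      unfolding mat_image_def module_vec_simps
      by (auto intro!: image_eqI[of _ _ "r \<cdot>\<^sub>v _"] eq_vecI)
  next
    fix a assume "a \<in> mat_image A" 
    then obtain x where x: "x \<in> carrier_vec (dim_col A)" "a = A *\<^sub>v x" by (auto simp: mat_image_def)
    have a: "a \<in> carrier_vec (dim_row A)" using x mult_mat_vec_carrier[of A "dim_row A" "dim_col A"] by auto
    have "\<ominus>\<^bsub>?V\<^esub> a = - a" using a
      by (intro M.minus_equality) (auto simp: module_vec_simps)
    also have "\<dots> = A *\<^sub>v (- x)" using x by (intro eq_vecI) (auto simp: scalar_prod_def sum_negf)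
    finally show "\<ominus>\<^bsub>?V\<^esub> a \<in> mat_image A" using x by (auto simp: mat_image_def)
  qed
  ultimately show ?thesis unfolding coker_module_def by (rule module_quot_module)
qed


section \<open>The Pontryagin dual of a discrete abelian group\<close>

text \<open>
  Characters are normalised to be \<^const>\<open>undefined\<close> off the carrier. The compact subsets of a
  discrete group are the finite ones, so the compact-open topology on the dual is the topology of
  pointwise convergence, i.e. the subspace topology inherited from the product \<open>(S\<^sup>1)\<^sup>M\<close>.
\<close>

definition dual_group :: "('m, 'b) ring_scheme \<Rightarrow> ('m \<Rightarrow> complex) monoid"
  where "dual_group M =
    \<lparr>carrier = {\<phi> \<in> carrier M \<rightarrow>\<^sub>E sphere 0 1.
        \<forall>x\<in>carrier M. \<forall>y\<in>carrier M. \<phi> (x \<oplus>\<^bsub>M\<^esub> y) = \<phi> x * \<phi> y},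
     monoid.mult = (\<lambda>\<phi> \<psi>. \<lambda>x\<in>carrier M. \<phi> x * \<psi> x),
     one = (\<lambda>x\<in>carrier M. 1)\<rparr>"

definition dual_topology :: "('m, 'b) ring_scheme \<Rightarrow> ('m \<Rightarrow> complex) topology"
  where "dual_topology M =
    subtopology (product_topology (\<lambda>_. top_of_set (sphere 0 1)) (carrier M)) (carrier (dual_group M))"

lemma dual_group_simps:
  "carrier (dual_group M) = {\<phi> \<in> carrier M \<rightarrow>\<^sub>E sphere 0 1.
        \<forall>x\<in>carrier M. \<forall>y\<in>carrier M. \<phi> (x \<oplus>\<^bsub>M\<^esub> y) = \<phi> x * \<phi> y}"
  "\<phi> \<otimes>\<^bsub>dual_group M\<^esub> \<psi> = (\<lambda>x\<in>carrier M. \<phi> x * \<psi> x)"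
  "\<one>\<^bsub>dual_group M\<^esub> = (\<lambda>x\<in>carrier M. 1)"
  by (simp_all add: dual_group_def)

lemma topspace_dual_topology: "topspace (dual_topology M) = carrier (dual_group M)"
  by (auto simp: dual_topology_def dual_group_simps topspace_product_topology)

lemma comm_group_dual_group:
  assumes "abelian_group M"
  shows "comm_group (dual_group M)"
proof -
  interpret abelian_group M by fact
  show ?thesis
  proof (rule comm_groupI)
    fix \<phi> assume \<phi>: "\<phi> \<in> carrier (dual_group M)"
    have "(\<lambda>x\<in>carrier M. cnj (\<phi> x)) \<in> carrier (dual_group M)"
      using \<phi> by (auto simp: dual_group_simps PiE_iff)
    moreover have "cnj (\<phi> x) * \<phi> x = 1" if "x \<in> carrier M" for x
    proof -
      have "cmod (\<phi> x) = 1" using \<phi> that by (auto simp: dual_group_simps PiE_iff)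
      thus ?thesis using complex_norm_square[of "\<phi> x"] by (simp add: mult.commute)
    qed
    ultimately show "\<exists>\<psi>\<in>carrier (dual_group M). \<psi> \<otimes>\<^bsub>dual_group M\<^esub> \<phi> = \<one>\<^bsub>dual_group M\<^esub>"
      by (intro bexI[of _ "\<lambda>x\<in>carrier M. cnj (\<phi> x)"])
        (auto simp: dual_group_simps restrict_def)
  qed (auto simp: dual_group_simps PiE_iff norm_mult extensional_def restrict_def mult_ac)
qed

lemma compact_Hausdorff_dual_topology:
  fixes M :: "('m, 'b) ring_scheme"
  assumes "abelian_group M"
  shows "compact_space (dual_topology M)" "Hausdorff_space (dual_topology M)"
proof -
  interpret abelian_group M by fact
  let ?P = "product_topology (\<lambda>_. top_of_set (sphere 0 1)) (carrier M) :: ('m \<Rightarrow> complex) topology"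
  have E: "Hausdorff_space (euclidean :: complex topology)"
    unfolding Hausdorff_space_def disjnt_def by (metis hausdorff open_openin)
  have H: "Hausdorff_space ?P" 
    unfolding Hausdorff_space_product_topology
    by (intro disjI2 ballI Hausdorff_space_subtopology E)
  have C: "compact_space ?P"
    by (auto simp: compact_space_product_topology compact_space_subtopology compactin_euclidean_iff)
  have cont: "continuous_map ?P euclidean (\<lambda>\<phi>. \<phi> x)" if "x \<in> carrier M" for x
    using continuous_map_product_projection[OF that, of "\<lambda>_. top_of_set (sphere 0 1)"]
    unfolding continuous_map_in_subtopology by blast
  have eq: "carrier (dual_group M) = topspace ?P \<inter> (\<Inter>x\<in>carrier M. \<Inter>y\<in>carrier M.
      {\<phi> \<in> topspace ?P. \<phi> (x \<oplus>\<^bsub>M\<^esub> y) - \<phi> x * \<phi> y \<in> {0}})"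
    by (auto simp: dual_group_simps)
  have cont2: "continuous_map ?P euclidean (\<lambda>\<phi>. \<phi> (x \<oplus>\<^bsub>M\<^esub> y) - \<phi> x * \<phi> y)"
    if "x \<in> carrier M" "y \<in> carrier M" for x y
    using cont[OF that(1)] cont[OF that(2)] cont[OF a_closed[OF that]]
    by (auto simp: continuous_map_atin intro!: tendsto_diff tendsto_mult)
  have "closedin ?P (topspace ?P \<inter> (\<Inter>x\<in>carrier M. \<Inter>y\<in>carrier M.
      {\<phi> \<in> topspace ?P. \<phi> (x \<oplus>\<^bsub>M\<^esub> y) - \<phi> x * \<phi> y \<in> {0}}))"
    by (intro closedin_Int closedin_topspace closedin_INT closedin_continuous_map_preimage[where Y=euclidean] cont2)
      auto
  hence "closedin ?P (carrier (dual_group M))" using eq by simp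
  thus "compact_space (dual_topology M)"
    using C unfolding dual_topology_def by (simp add: closedin_compact_space compact_space_subtopology)
  show "Hausdorff_space (dual_topology M)"
    unfolding dual_topology_def by (intro Hausdorff_space_subtopology H)
qed

definition dual_action ::
  "('d laurent, 'm, 'b) module_scheme \<Rightarrow> 'd zvec \<Rightarrow> ('m \<Rightarrow> complex) \<Rightarrow> 'm \<Rightarrow> complex"
  where "dual_action M n \<phi> = (\<lambda>x\<in>carrier M. \<phi> (umonom n \<odot>\<^bsub>M\<^esub> x))"

lemma dual_action_automorphisms:
  assumes "module class_ring M"
  shows "dual_action M n \<in> hom (dual_group M) (dual_group M)"
    "continuous_map (dual_topology M) (dual_topology M) (dual_action M n)"
    "\<phi> \<in> carrier (dual_group M) \<Longrightarrow> dual_action M 0 \<phi> = \<phi>"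
    "\<phi> \<in> carrier (dual_group M) \<Longrightarrow> dual_action M (m + n) \<phi> = dual_action M m (dual_action M n \<phi>)"
proof -
  interpret module class_ring M by fact
  have u: "umonom n \<odot>\<^bsub>M\<^esub> x \<in> carrier M" if "x \<in> carrier M" for n x
    using smult_closed[of "umonom n" x] that by simp
  have ud: "umonom n \<odot>\<^bsub>M\<^esub> (x \<oplus>\<^bsub>M\<^esub> y) = umonom n \<odot>\<^bsub>M\<^esub> x \<oplus>\<^bsub>M\<^esub> umonom n \<odot>\<^bsub>M\<^esub> y"
    if "x \<in> carrier M" "y \<in> carrier M" for n x y
    using smult_r_distr[of "umonom n" x y] that by simp
  have c: "dual_action M n \<phi> \<in> carrier (dual_group M)" if "\<phi> \<in> carrier (dual_group M)" for n \<phi>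
    using that by (auto simp: dual_action_def dual_group_simps PiE_iff u ud)
  show "dual_action M n \<in> hom (dual_group M) (dual_group M)"
    by (rule homI) (auto simp: c, auto simp: dual_action_def dual_group_simps u fun_eq_iff)
  show "continuous_map (dual_topology M) (dual_topology M) (dual_action M n)"
    unfolding dual_topology_def
  proof (rule continuous_map_into_subtopology, unfold continuous_map_componentwise, intro conjI ballI)
    fix x assume x: "x \<in> carrier M"
    show "continuous_map (subtopology (product_topology (\<lambda>_. top_of_set (sphere 0 1)) (carrier M))
            (carrier (dual_group M))) (top_of_set (sphere 0 1)) (\<lambda>\<phi>. dual_action M n \<phi> x)"
      using x continuous_map_product_projection[OF u[OF x], of "\<lambda>_. top_of_set (sphere 0 1)"]
      by (simp add: dual_action_def) (rule continuous_map_from_subtopology)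
  qed (use c in \<open>auto simp: dual_action_def topspace_product_topology\<close>)
  show "dual_action M 0 \<phi> = \<phi>" if "\<phi> \<in> carrier (dual_group M)"
    using that smult_one by (auto simp: dual_action_def umonom_0 dual_group_simps fun_eq_iff PiE_iff extensional_def)
  show "dual_action M (m + n) \<phi> = dual_action M m (dual_action M n \<phi>)"
    using smult_assoc1[of "umonom m" "umonom n"] smult_assoc1[of "umonom n" "umonom m"] by (auto simp: dual_action_def umonom_add u fun_eq_iff mult.commute)
qed


section \<open>Expansiveness\<close>

definition expansive :: "'x topology \<Rightarrow> ('x, 'b) monoid_scheme \<Rightarrow> ('i \<Rightarrow> 'x \<Rightarrow> 'x) \<Rightarrow> bool"
  where "expansive T G \<alpha> \<longleftrightarrow>
    (\<exists>N U. openin T U \<and> \<one>\<^bsub>G\<^esub> \<in> U \<and> U \<subseteq> N \<and> N \<subseteq> topspace T \<and> (\<Inter>n. \<alpha> n ` N) = {\<one>\<^bsub>G\<^esub>})"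

end

theory Submission
  imports
    Defs
    "HOL-Analysis.Complex_Transcendental"
    "HOL-Real_Asymp.Real_Asymp"
begin

text \<open>
  Write \<open>R\<close> for the ring of Laurent polynomials. A character of the cokernel is a character \<open>\<phi>\<close> of
  \<open>R\<^sup>k\<close> that is trivial on the image of \<open>A\<close>, and the action replaces \<open>\<phi>\<close> by
  \<open>v \<mapsto> \<phi> (u\<^sup>m v)\<close>.

  Suppose first that all maximal minors vanish at a point \<open>z\<close> of the torus. Then the complex matrix
  \<open>A(z)\<close> has a nonzero left null vector (lemma \<open>minor_zero_left_null_vector\<close>), which can be scaled
  to a vector \<open>w\<close> with a coordinate equal to \<open>1\<close>, and
  \<open>v \<mapsto> cis (e * Re (\<Sum>i. w i * v i (z)))\<close> is a character of the cokernel for every real \<open>e\<close>. As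
  all monomials have modulus \<open>1\<close> at \<open>z\<close>, shifting it changes the sum only by a factor of modulus
  \<open>1\<close>. For small \<open>e > 0\<close> the character is therefore nontrivial, while its whole orbit stays in a
  prescribed neighbourhood of the identity (lemma \<open>not_expansive_if_left_null\<close>).

  Suppose conversely that the minors have no common zero on the torus, and let the whole orbit of
  \<open>\<phi>\<close> stay close to the identity. Then the values of \<open>\<phi>\<close> on the multiples \<open>u\<^sup>m e\<^sub>i\<close> of the unit
  vectors have uniformly small arguments, which extend to additive maps \<open>\<tau>\<^sub>i : R \<rightarrow> \<real>\<close>.
  Triviality of \<open>\<phi>\<close> on the monomial multiples of the columns of \<open>A\<close> says that certain integer
  combinations of these arguments, with the coefficients of the entries of \<open>A\<close>, are multiples of
  \<open>2\<pi>\<close>; being small, they vanish, so \<open>\<Sum>i. \<tau>\<^sub>i (v i) = 0\<close> for every \<open>v\<close> in the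
  image of \<open>A\<close>. By Cramer's rule the image of \<open>A\<close> contains \<open>det B \<cdot> R\<^sup>k\<close> for each maximal
  square submatrix \<open>B\<close> (lemma \<open>det_smult_in_mat_image\<close>), hence each \<open>\<tau>\<^sub>i\<close> kills the ideal
  generated by the minors.

  It remains to see that a bounded additive map \<open>\<tau>\<close> killing an ideal without zeros on the torus is
  zero (lemma \<open>bounded_additive_eq_0\<close>). This is a case of Wiener's lemma, but it has a direct
  proof. The ideal contains \<open>g = \<Sum>f. f\<^sup>* f\<close>, which is positive on the torus. For a large integer
  \<open>c\<close> the Laurent polynomial \<open>p = c - g\<close> satisfies \<open>0 \<le> p \<le> s < c\<close> on the torus, and
  \<open>c\<^sup>n \<tau>(u\<^sup>m) = \<tau>(p\<^sup>n u\<^sup>m)\<close> for all \<open>n\<close>. The coefficients of \<open>p\<^sup>n\<close> are Fourier coefficients, so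
  each is at most \<open>s\<^sup>n\<close>, and their number grows only polynomially in \<open>n\<close>; dividing by \<open>c\<^sup>n\<close> and
  letting \<open>n\<close> tend to infinity gives \<open>\<tau>(u\<^sup>m) = 0\<close>.
\<close>

unbundle no vec_syntax


section \<open>Additive maps on the Laurent polynomial ring\<close>

lemma laurent_induct [case_names zero umonom diff]:
  fixes f :: "'d laurent"
  assumes "P 0" "\<And>m. P (umonom m)" "\<And>f g. P f \<Longrightarrow> P g \<Longrightarrow> P (f - g)"
  shows "P f"
  using frag_induction[of f UNIV P] assms by (simp add: umonom_def)

definition lin_ext :: "('d zvec \<Rightarrow> 'a::ring_1) \<Rightarrow> 'd laurent \<Rightarrow> 'a"
  where "lin_ext h f = (\<Sum>m\<in>Poly_Mapping.keys f. of_int (Poly_Mapping.lookup f m) * h m)"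

lemma additive_lin_ext: "additive (lin_ext h)"
  unfolding lin_ext_def
  by unfold_locales (rule setsum_keys_plus_distrib; simp add: algebra_simps)

lemma lin_ext_umonom [simp]: "lin_ext h (umonom m) = h m"
  by (simp add: lin_ext_def umonom_def)

text \<open>
  The monomials generate the additive group of Laurent polynomials. Identities that are additive in
  each argument, such as multiplicativity of evaluation, are checked on monomials by this rule.
\<close>

lemma additive_laurent_eqI:
  assumes "additive s" "additive t" "\<And>m. s (umonom m) = t (umonom m)"
  shows "s f = t (f :: 'd laurent)"
  using assms by (induction f rule: laurent_induct) (auto simp: additive.zero additive.diff)

lemma additive_mult_right: "additive (\<lambda>f. t (f * g))" if "additive t" for t :: "'a::ring \<Rightarrow> 'b::ab_group_add"
  using that by (simp add: additive_def distrib_right)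

lemma additive_mult_left: "additive (\<lambda>f. t (g * f))" if "additive t" for t :: "'a::ring \<Rightarrow> 'b::ab_group_add"
  using that by (simp add: additive_def distrib_left)

lemma additive_of_int_mult:
  fixes t :: "'a::ring_1 \<Rightarrow> 'b::ring_1"
  assumes "additive t"
  shows "t (of_int c * h) = of_int c * t h"
  by (induction c rule: int_induct[of _ 0])
    (simp_all add: algebra_simps additive.zero[OF assms] additive.add[OF assms] additive.diff[OF assms])

lemma additive_eq_lin_ext:
  fixes t :: "'d laurent \<Rightarrow> 'a::ring_1"
  assumes "additive t"
  shows "t f = lin_ext (\<lambda>m. t (umonom m)) f"
  by (rule additive_laurent_eqI[OF assms additive_lin_ext]) simp

text \<open>
  The \<open>\<ell>\<^sup>1\<close>-norm of the coefficient family.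
\<close>

definition coeff_norm :: "'d laurent \<Rightarrow> int"
  where "coeff_norm f = (\<Sum>m\<in>Poly_Mapping.keys f. \<bar>Poly_Mapping.lookup f m\<bar>)"

lemma coeff_norm_nonneg: "coeff_norm f \<ge> 0"
  by (simp add: coeff_norm_def sum_nonneg)

lemma additive_bound:
  fixes t :: "'d laurent \<Rightarrow> 'a::real_normed_algebra_1"
  assumes "additive t" and "\<And>m. norm (t (umonom m)) \<le> C"
  shows "norm (t f) \<le> C * real_of_int (coeff_norm f)"
proof -
  have "norm (t f) \<le> (\<Sum>m\<in>Poly_Mapping.keys f. norm (of_int (Poly_Mapping.lookup f m) * t (umonom m)))"
    by (subst additive_eq_lin_ext[OF assms(1)]) (auto simp: lin_ext_def intro: norm_sum)
  also have "\<dots> \<le> (\<Sum>m\<in>Poly_Mapping.keys f. \<bar>real_of_int (Poly_Mapping.lookup f m)\<bar> * C)"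
    by (intro sum_mono order.trans[OF norm_mult_ineq] mult_mono assms) (auto simp: norm_of_int)
  finally show ?thesis
    by (simp add: coeff_norm_def sum_distrib_left mult.commute)
qed


section \<open>Evaluation on the torus\<close>

text \<open>
  The points of the torus are the characters of the group of exponent vectors; for \<open>z\<close> in the torus
  this is the character belonging to \<open>z\<close>.
\<close>

definition char_at :: "('d::finite \<Rightarrow> complex) \<Rightarrow> 'd zvec \<Rightarrow> complex"
  where "char_at z m = (\<Prod>i\<in>UNIV. z i powi Poly_Mapping.lookup m i)"

lemma laurent_eval_eq: "laurent_eval f z = lin_ext (char_at z) f"
  by (simp add: laurent_eval_def lin_ext_def char_at_def)

lemma char_at_0 [simp]: "char_at z 0 = 1"
  by (simp add: char_at_def)

lemma unit_torus_nz: "z \<in> unit_torus \<Longrightarrow> z i \<noteq> 0"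
  unfolding unit_torus_def by (metis (mono_tags) mem_Collect_eq norm_zero zero_neq_one)

lemma char_at_add:
  assumes "z \<in> unit_torus"
  shows "char_at z (m + n) = char_at z m * char_at z n"
  by (simp add: char_at_def lookup_add power_int_add unit_torus_nz[OF assms] prod.distrib)

lemma char_at_uminus: "z \<in> unit_torus \<Longrightarrow> char_at z (- m) = cnj (char_at z m)"
proof -
  assume z: "z \<in> unit_torus"
  have "z i powi (- e) = cnj (z i powi e)" for i e
  proof -
    have "z i * cnj (z i) = 1"
      using z complex_norm_square[of "z i"] by (simp add: unit_torus_def)
    hence *: "inverse (z i) = cnj (z i)" by (rule inverse_unique)
    have "z i powi (- e) = inverse (z i) powi e"
      by (simp only: power_int_minus power_int_inverse)
    thus ?thesis unfolding * by simp
  qed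
  thus ?thesis by (simp add: char_at_def)
qed

lemma norm_char_at: "z \<in> unit_torus \<Longrightarrow> norm (char_at z m) = 1"
  by (simp add: char_at_def prod_norm[symmetric] norm_power_int unit_torus_def)

lemma additive_eval: "additive (\<lambda>f. laurent_eval f z)"
  unfolding laurent_eval_eq by (rule additive_lin_ext)

lemma laurent_eval_umonom [simp]: "laurent_eval (umonom m) z = char_at z m"
  by (simp add: laurent_eval_eq)

lemma laurent_eval_of_int: "laurent_eval (of_int c) z = of_int c"
  by (cases "c = 0") (simp_all add: laurent_eval_eq lin_ext_def flip: single_of_int)

lemma laurent_eval_mult:
  assumes z: "z \<in> unit_torus"
  shows "laurent_eval (f * g) z = laurent_eval f z * laurent_eval g z"
proof -
  have *: "laurent_eval (umonom m * g) z = char_at z m * laurent_eval g z" for m g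
    by (rule additive_laurent_eqI[OF additive_mult_left[OF additive_eval]
          additive.intro])
      (simp_all add: char_at_add[OF z] flip: umonom_add, simp add: additive.add[OF additive_eval] distrib_left)
  show ?thesis
    by (rule additive_laurent_eqI[OF additive_mult_right[OF additive_eval] additive.intro])
      (simp_all add: *, simp add: additive.add[OF additive_eval] distrib_right)
qed

lemma comm_ring_hom_eval:
  assumes "z \<in> unit_torus"
  shows "comm_ring_hom (\<lambda>f. laurent_eval f z)"
  by unfold_locales
    (auto simp: additive.add[OF additive_eval] additive.zero[OF additive_eval] laurent_eval_mult assms
       simp flip: umonom_0)

text \<open>
  The involution \<open>u \<mapsto> u\<^sup>-\<^sup>1\<close> of the group ring. It represents complex conjugation of the values on the
  torus inside the integral Laurent polynomials.
\<close>

definition laurent_star :: "'d laurent \<Rightarrow> 'd laurent"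
  where "laurent_star = lin_ext (\<lambda>m. umonom (- m))"

lemma laurent_eval_star:
  assumes z: "z \<in> unit_torus"
  shows "laurent_eval (laurent_star f) z = cnj (laurent_eval f z)"
  unfolding laurent_star_def
  by (rule additive_laurent_eqI; (intro additive.intro)?)
     (simp_all add: additive.add[OF additive_eval] additive.add[OF additive_lin_ext] char_at_uminus z)

lemma compact_unit_torus: "compact (unit_torus :: ('d::finite \<Rightarrow> complex) set)"
proof -
  have "compactin (product_topology (\<lambda>_::'d. euclidean) UNIV) (PiE UNIV (\<lambda>_. sphere (0::complex) 1))"
    by (simp add: compactin_PiE)
  moreover have "PiE UNIV (\<lambda>_::'d. sphere (0::complex) 1) = unit_torus"
    by (auto simp: unit_torus_def PiE_def)
  ultimately show ?thesis
    by (simp add: euclidean_product_topology)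
qed

lemma continuous_on_eval: "continuous_on unit_torus (laurent_eval f)"
  unfolding laurent_eval_def
  by (intro continuous_intros continuous_on_product_coordinates continuous_on_subset[OF continuous_on_product_coordinates])
     (auto dest: unit_torus_nz)


section \<open>Bounded functions annihilated by Laurent polynomials without common zero\<close>

lemma sum_root_of_unity_powi:
  fixes e :: int
  assumes "\<bar>e\<bar> < int N"
  shows "(\<Sum>j<N. cis (2 * pi * real j / real N) powi e) = (if e = 0 then of_nat N else 0)"
proof (cases "e = 0")
  case False
  let ?w = "cis (2 * pi * (real_of_int e / real N))"
  have N: "N > 0" using assms by auto
  have w: "?w \<noteq> 1"
  proof
    assume "?w = 1"
    hence "cos (2 * pi * (real_of_int e / real N)) = 1" by (simp add: cis.ctr complex_eq_iff)
    then obtain k :: int where "2 * pi * (real_of_int e / real N) = of_int k * 2 * pi"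
      using cos_one_2pi_int by blast
    hence "real_of_int e = of_int k * real N" using N by (simp add: field_simps)
    hence "e = k * int N" by (metis of_int_eq_iff of_int_mult of_int_of_nat_eq)
    thus False using assms False N
      by (metis abs_mult abs_of_nat dvd_imp_le_int dvd_triv_right linorder_not_less)
  qed
  have "(\<Sum>j<N. cis (2 * pi * real j / real N) powi e) = (\<Sum>j<N. ?w ^ j)"
    by (intro sum.cong refl) (simp add: cis_power_int Complex.DeMoivre mult_ac)
  also have "\<dots> = (?w ^ N - 1) / (?w - 1)"
    using w by (simp add: geometric_sum)
  also have "?w ^ N = cis (2 * pi * real_of_int e)"
    using N by (simp add: Complex.DeMoivre)
  also have "\<dots> = 1" by (rule cis_multiple_2pi) auto
  finally show ?thesis using False by simp
qed simp

definition zvec_cube :: "nat \<Rightarrow> 'd::finite zvec set"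
  where "zvec_cube L = {m. \<forall>i. \<bar>Poly_Mapping.lookup m i\<bar> \<le> int L}"

lemma finite_card_zvec_cube:
  "finite (zvec_cube L :: 'd::finite zvec set)" "card (zvec_cube L :: 'd::finite zvec set) \<le> (2 * L + 1) ^ CARD('d)"
proof -
  let ?P = "PiE (UNIV :: 'd set) (\<lambda>_. {- int L..int L})"
  have sub: "Poly_Mapping.lookup ` (zvec_cube L :: 'd zvec set) \<subseteq> ?P"
    by (auto simp: zvec_cube_def abs_le_iff) (metis minus_le_iff)
  have inj: "inj_on Poly_Mapping.lookup (zvec_cube L :: 'd zvec set)"
    by (auto intro: inj_onI poly_mapping_eqI)
  have fin: "finite ?P" by (intro finite_PiE) auto
  show "finite (zvec_cube L :: 'd zvec set)"
    using finite_imageD[OF finite_subset[OF sub fin] inj] .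
  have "card (zvec_cube L :: 'd zvec set) \<le> card ?P"
    using card_inj_on_le[OF inj sub fin] .
  also have "\<dots> = (2 * L + 1) ^ CARD('d)"
    by (simp add: card_PiE nat_add_distrib nat_mult_distrib)
  finally show "card (zvec_cube L :: 'd::finite zvec set) \<le> (2 * L + 1) ^ CARD('d)" .
qed

lemma finite_subset_zvec_cube:
  fixes S :: "'d::finite zvec set"
  assumes "finite S"
  obtains L where "S \<subseteq> zvec_cube L"
proof -
  let ?T = "(\<lambda>(m,i). nat \<bar>Poly_Mapping.lookup m i\<bar>) ` (S \<times> UNIV)"
  have "finite ?T" using assms by auto
  hence "S \<subseteq> zvec_cube (Max ?T)"
    by (force simp: zvec_cube_def le_nat_iff[symmetric] nat_le_iff[symmetric] intro!: Max_ge)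
  thus ?thesis using that by blast
qed

text \<open>
  A coefficient is an average of the values of \<open>f\<close> times a character over the torus, hence bounded by
  the supremum of \<open>f\<close>. For a Laurent polynomial the average over the finite group of \<open>N\<close>-th roots of
  unity already isolates the coefficient, once \<open>N\<close> exceeds all differences of exponents.
\<close>

lemma lookup_bound:
  fixes f :: "'d::finite laurent"
  assumes "\<And>z. z \<in> unit_torus \<Longrightarrow> norm (laurent_eval f z) \<le> s"
  shows "\<bar>real_of_int (Poly_Mapping.lookup f m)\<bar> \<le> s"
proof -
  obtain L where L: "insert m (Poly_Mapping.keys f) \<subseteq> zvec_cube L"
    using finite_subset_zvec_cube[of "insert m (Poly_Mapping.keys f)"] by auto
  \<comment> \<open>The exponents of \<open>f\<close> and \<open>m\<close> differ by at most \<open>2 * L\<close> in each coordinate, so two of them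
    are congruent modulo \<open>N\<close> only if they agree.\<close>
  define N where "N = 2 * L + 1"
  define w where "w a = (\<lambda>i::'d. cis (2 * pi * real (a i) / real N))" for a
  define G where "G = PiE (UNIV :: 'd set) (\<lambda>_. {..<N})"
  have wT: "w a \<in> unit_torus" for a by (simp add: w_def unit_torus_def)
  have orth: "(\<Sum>a\<in>G. char_at (w a) (m' - m)) = (if m' = m then of_nat (N ^ CARD('d)) else 0)"
    if "m' \<in> insert m (Poly_Mapping.keys f)" for m'
  proof -
    have e: "\<bar>Poly_Mapping.lookup (m' - m) i\<bar> < int N" for i
    proof -
      have "\<bar>Poly_Mapping.lookup m' i\<bar> \<le> int L" "\<bar>Poly_Mapping.lookup m i\<bar> \<le> int L"
        using L that by (auto simp: zvec_cube_def)
      thus ?thesis by (simp add: lookup_minus N_def)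
    qed
    have "(\<Sum>a\<in>G. char_at (w a) (m' - m)) =
        (\<Prod>i\<in>UNIV. \<Sum>j<N. cis (2 * pi * real j / real N) powi Poly_Mapping.lookup (m' - m) i)"
      unfolding G_def char_at_def w_def by (rule prod_sum_PiE[symmetric]) auto
    also have "\<dots> = (\<Prod>i\<in>(UNIV::'d set). if Poly_Mapping.lookup (m' - m) i = 0 then of_nat N else 0)"
      by (intro prod.cong refl sum_root_of_unity_powi e)
    also have "\<dots> = (if m' = m then of_nat (N ^ CARD('d)) else 0)"
    proof (cases "m' = m")
      case False
      then obtain i where "Poly_Mapping.lookup (m' - m) i \<noteq> 0"
        by (metis eq_iff_diff_eq_0 poly_mapping_eqI lookup_zero)
      thus ?thesis using False by (auto intro: prod_zero)
    qed simp
    finally show ?thesis .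
  qed
  have cardG: "card G = N ^ CARD('d)" by (simp add: G_def card_PiE)
  have "(\<Sum>a\<in>G. laurent_eval f (w a) * char_at (w a) (- m)) =
      (\<Sum>a\<in>G. \<Sum>m'\<in>Poly_Mapping.keys f. of_int (Poly_Mapping.lookup f m') * char_at (w a) (m' - m))"
    unfolding laurent_eval_eq lin_ext_def
    by (simp add: sum_distrib_right mult.assoc char_at_add[OF wT, of _ _ "- m", simplified])
  also have "\<dots> = (\<Sum>m'\<in>Poly_Mapping.keys f. of_int (Poly_Mapping.lookup f m') * (\<Sum>a\<in>G. char_at (w a) (m' - m)))"
    by (subst sum.swap) (simp add: sum_distrib_left)
  also have "\<dots> = (\<Sum>m'\<in>Poly_Mapping.keys f. if m' = m then of_int (Poly_Mapping.lookup f m) * of_nat (N ^ CARD('d)) else 0)"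
    by (intro sum.cong refl) (simp add: orth)
  also have "\<dots> = of_int (Poly_Mapping.lookup f m) * of_nat (N ^ CARD('d))"
    by (simp add: in_keys_iff)
  finally have "norm (of_int (Poly_Mapping.lookup f m) * (of_nat (N ^ CARD('d)) :: complex)) \<le>
      (\<Sum>a\<in>G. norm (laurent_eval f (w a) * char_at (w a) (- m)))"
    by (metis norm_sum)
  also have "\<dots> \<le> (\<Sum>a\<in>G. s)"
    by (intro sum_mono) (simp add: norm_mult norm_char_at wT assms)
  finally have "\<bar>real_of_int (Poly_Mapping.lookup f m)\<bar> * real (N ^ CARD('d)) \<le> s * real (N ^ CARD('d))"
    by (simp add: norm_mult cardG norm_power mult.commute)
  thus ?thesis by (simp add: N_def)
qed

lemma keys_power_subset:
  fixes f :: "'d::finite laurent"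
  assumes "Poly_Mapping.keys f \<subseteq> zvec_cube L"
  shows "Poly_Mapping.keys (f ^ n) \<subseteq> zvec_cube (n * L)"
proof (induction n)
  case (Suc n)
  show ?case
  proof
    fix m assume "m \<in> Poly_Mapping.keys (f ^ Suc n)"
    then obtain a b where ab: "m = a + b" "a \<in> Poly_Mapping.keys f" "b \<in> Poly_Mapping.keys (f ^ n)"
      using keys_mult[of f "f ^ n"] by auto
    show "m \<in> zvec_cube (Suc n * L)" unfolding zvec_cube_def
    proof (intro CollectI allI)
      fix i
      have "\<bar>Poly_Mapping.lookup a i\<bar> \<le> int L" "\<bar>Poly_Mapping.lookup b i\<bar> \<le> int (n * L)"
        using ab assms Suc by (auto simp: zvec_cube_def)
      thus "\<bar>Poly_Mapping.lookup m i\<bar> \<le> int (Suc n * L)"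
        unfolding ab lookup_add by simp
    qed
  qed
qed (auto simp: zvec_cube_def)

text \<open>
  Up to a polynomial factor, the \<open>\<ell>\<^sup>1\<close>-norm of a power grows no faster than the power of the supremum
  norm: the support of \<open>f ^ n\<close> lies in a cube of side proportional to \<open>n\<close>, and every coefficient is at
  most \<open>s ^ n\<close>.
\<close>

lemma coeff_norm_power_bound:
  fixes f :: "'d::finite laurent"
  assumes "\<And>z. z \<in> unit_torus \<Longrightarrow> norm (laurent_eval f z) \<le> s" and "Poly_Mapping.keys f \<subseteq> zvec_cube L"
  shows "real_of_int (coeff_norm (f ^ n)) \<le> real ((2 * (n * L) + 1) ^ CARD('d)) * s ^ n"
proof -
  have "norm (laurent_eval (f ^ n) z) \<le> s ^ n" if z: "z \<in> unit_torus" for z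
  proof -
    interpret comm_ring_hom "\<lambda>f. laurent_eval f z" by (rule comm_ring_hom_eval[OF z])
    show ?thesis using assms(1)[OF z] by (simp add: hom_power norm_power power_mono)
  qed
  note b = lookup_bound[OF this]
  have "0 \<le> s ^ n" using b[of 0] by linarith
  have "real_of_int (coeff_norm (f ^ n)) \<le> (\<Sum>m\<in>Poly_Mapping.keys (f ^ n). s ^ n)"
    unfolding coeff_norm_def of_int_sum by (intro sum_mono) (use b in auto)
  also have "\<dots> = real (card (Poly_Mapping.keys (f ^ n))) * s ^ n" by simp
  also have "card (Poly_Mapping.keys (f ^ n)) \<le> card (zvec_cube (n * L) :: 'd zvec set)"
    by (intro card_mono finite_card_zvec_cube keys_power_subset assms)
  also have "\<dots> \<le> (2 * (n * L) + 1) ^ CARD('d)" by (rule finite_card_zvec_cube)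
  finally show ?thesis using \<open>0 \<le> s ^ n\<close> by (simp add: mult_right_mono)
qed

lemma poly_geometric_tendsto_0:
  fixes q :: real
  assumes "0 \<le> q" "q < 1"
  shows "(\<lambda>n. real ((2 * (n * L) + 1) ^ D) * q ^ n) \<longlonglongrightarrow> 0"
proof (cases "q = 0")
  case True
  show ?thesis by (rule tendsto_eventually) (auto simp: True eventually_at_top_linorder intro!: exI[of _ 1])
next
  case False
  hence "0 < q" using assms by simp
  have "(\<lambda>n. (2 * (real n * real L) + 1) ^ D * q ^ n) \<longlonglongrightarrow> 0"
  proof (cases "L = 0")
    case True
    thus ?thesis using assms by (simp add: LIMSEQ_power_zero)
  next
    case False
    \<comment> \<open>With \<open>L\<close> and \<open>q\<close> positive, the asymptotic behaviour is decided by the signs of the parameters.\<close>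
    define l where "l = real L"
    have "l > 0" using False by (simp add: l_def)
    thus ?thesis unfolding l_def[symmetric] using \<open>0 < q\<close> assms by real_asymp
  qed
  thus ?thesis by (simp add: add.commute)
qed

text \<open>
  The elementary substitute for Wiener's lemma. The sum \<open>g\<close> of the \<open>f\<^sup>* f\<close> is bounded away from zero
  on the compact torus, so \<open>p = c - g\<close> has supremum norm less than \<open>c\<close> there. As \<open>\<tau>\<close> kills the
  multiples of \<open>g\<close>, multiplication by \<open>p\<close> acts under \<open>\<tau>\<close> like multiplication by \<open>c\<close>, which the
  growth of the powers of \<open>p\<close> allows only if \<open>\<tau>\<close> vanishes.
\<close>

lemma bounded_additive_eq_0:
  fixes \<tau> :: "'d::finite laurent \<Rightarrow> real" and F :: "'d laurent set"
  assumes \<tau>: "additive \<tau>" "\<And>m. \<bar>\<tau> (umonom m)\<bar> \<le> C"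
    and F: "finite F" "\<And>f g. f \<in> F \<Longrightarrow> \<tau> (f * g) = 0"
    and nz: "\<And>z. z \<in> unit_torus \<Longrightarrow> \<exists>f\<in>F. laurent_eval f z \<noteq> 0"
  shows "\<tau> h = 0"
proof -
  define g where "g = (\<Sum>f\<in>F. laurent_star f * f)"
  define G where "G z = (\<Sum>f\<in>F. (norm (laurent_eval f z))\<^sup>2)" for z
  have eval_g: "laurent_eval g z = of_real (G z)" if z: "z \<in> unit_torus" for z
  proof -
    interpret comm_ring_hom "\<lambda>f. laurent_eval f z" by (rule comm_ring_hom_eval[OF z])
    show ?thesis
      by (simp add: g_def G_def hom_sum hom_mult laurent_eval_star[OF z] complex_norm_square
          mult.commute[of "cnj _"] del: of_real_power)
  qed
  have G_pos: "G z > 0" if "z \<in> unit_torus" for z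
    using nz[OF that] F(1) unfolding G_def by (metis sum_pos2 zero_le_power2 zero_less_norm_iff zero_less_power)
  have ne: "unit_torus \<noteq> ({} :: ('d \<Rightarrow> complex) set)"
    by (auto simp: unit_torus_def intro!: exI[of _ "\<lambda>_. 1"])
  have contG: "continuous_on (unit_torus :: ('d \<Rightarrow> complex) set) G" unfolding G_def
    by (intro continuous_intros continuous_on_eval)
  obtain z0 :: "'d \<Rightarrow> complex" where z0: "z0 \<in> unit_torus" "\<And>z. z \<in> unit_torus \<Longrightarrow> G z0 \<le> G z"
    using continuous_attains_inf[OF compact_unit_torus ne contG] by blast
  \<comment> \<open>An integer bound for \<open>g\<close> on the torus, so that \<open>p\<close> has integer coefficients; the summand
    \<open>1\<close> makes it positive.\<close>
  define c where "c = coeff_norm g + 1"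
  have c: "c > 0" using coeff_norm_nonneg[of g] by (simp add: c_def)
  have G_le: "G z \<le> real_of_int c" if z: "z \<in> unit_torus" for z
  proof -
    have "norm (laurent_eval g z) \<le> 1 * real_of_int (coeff_norm g)"
      by (rule additive_bound[OF additive_eval]) (simp add: norm_char_at z)
    thus ?thesis using eval_g[OF z] G_pos[OF z] by (simp add: c_def)
  qed
  define p where "p = of_int c - g"
  define s where "s = real_of_int c - G z0"
  have p_le: "norm (laurent_eval p z) \<le> s" if z: "z \<in> unit_torus" for z
  proof -
    interpret comm_ring_hom "\<lambda>f. laurent_eval f z" by (rule comm_ring_hom_eval[OF z])
    have "laurent_eval p z = of_real (real_of_int c - G z)"
      by (simp add: p_def hom_minus eval_g[OF z] laurent_eval_of_int)
    thus ?thesis using G_le[OF z] z0(2)[OF z] unfolding s_def by (simp only: norm_of_real)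
  qed
  have s: "0 \<le> s" "s < c" using G_le[OF z0(1)] G_pos[OF z0(1)] by (auto simp: s_def)
  obtain L where L: "Poly_Mapping.keys p \<subseteq> zvec_cube L"
    using finite_subset_zvec_cube[of "Poly_Mapping.keys p"] by auto
  have sum0: "\<tau> (sum X S) = (\<Sum>x\<in>S. \<tau> (X x))" for X and S :: "'d laurent set" by (rule additive.sum[OF \<tau>(1)])
  have \<tau>g: "\<tau> (g * h) = 0" for h
    using F(2) by (simp add: g_def sum_distrib_right sum0 mult.assoc mult.left_commute[of "laurent_star _"])
  have \<tau>c: "\<tau> (of_int c * h) = of_int c * \<tau> h" for h
    by (rule additive_of_int_mult[OF \<tau>(1)])
  have step: "of_int c ^ n * \<tau> h = \<tau> (p ^ n * h)" for n h
  proof (induction n arbitrary: h)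
    case (Suc n)
    have "\<tau> (p * h) = of_int c * \<tau> h"
      by (simp add: p_def left_diff_distrib additive.diff[OF \<tau>(1)] \<tau>g \<tau>c)
    thus ?case using Suc[of "p * h"] by (simp add: mult_ac)
  qed simp
  have "\<tau> (umonom m) = 0" for m
  proof -
    have "\<bar>\<tau> (umonom m)\<bar> \<le> C * (real ((2 * (n * L) + 1) ^ CARD('d)) * (s / c) ^ n)" for n
    proof -
      have C: "0 \<le> C" using \<tau>(2)[of 0] by linarith
      have "norm (\<tau> (p ^ n * umonom m)) \<le> C * real_of_int (coeff_norm (p ^ n))"
        by (rule additive_bound[OF additive_mult_right[OF \<tau>(1)]]) (simp add: \<tau> flip: umonom_add)
      also have "\<dots> \<le> C * (real ((2 * (n * L) + 1) ^ CARD('d)) * s ^ n)"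
        by (intro mult_left_mono C coeff_norm_power_bound p_le L)
      finally have "of_int c ^ n * \<bar>\<tau> (umonom m)\<bar> \<le> C * (real ((2 * (n * L) + 1) ^ CARD('d)) * s ^ n)"
        using c by (simp add: step[symmetric] abs_mult power_abs)
      thus ?thesis using c by (simp add: power_divide field_simps)
    qed
    moreover have "(\<lambda>n. C * (real ((2 * (n * L) + 1) ^ CARD('d)) * (s / c) ^ n)) \<longlonglongrightarrow> C * 0"
      by (intro tendsto_mult tendsto_const poly_geometric_tendsto_0) (use s c in auto)
    ultimately have "\<bar>\<tau> (umonom m)\<bar> \<le> C * 0"
      by (intro LIMSEQ_le_const) auto
    thus ?thesis by simp
  qed
  thus ?thesis by (subst additive_eq_lin_ext[OF \<tau>(1)]) (simp add: lin_ext_def)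
qed


section \<open>Maximal minors\<close>

text \<open>
  Cramer's rule: with \<open>B\<close> the square submatrix, \<open>B\<close> maps \<open>adj B *\<^sub>v v\<close> to \<open>det B \<cdot>\<^sub>v v\<close>, and
  the image of \<open>B\<close> lies in that of \<open>A\<close> since a vector can be extended by zeros off \<open>J\<close>.
\<close>

lemma det_smult_in_mat_image:
  fixes A :: "'a::comm_ring_1 mat"
  assumes A: "A \<in> carrier_mat k n" and J: "J \<subseteq> {..<n}" "card J = k" and v: "v \<in> carrier_vec k"
  shows "Determinant.det (submatrix A UNIV J) \<cdot>\<^sub>v v \<in> mat_image A"
proof -
  define B where "B = submatrix A UNIV J"
  have fin: "finite J" using J finite_subset by blast
  have Jn: "{j. j < n \<and> j \<in> J} = J" using J by auto
  have B: "B \<in> carrier_mat k k"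
    unfolding B_def by (rule carrier_matI) (simp_all add: dim_submatrix Jn J carrier_matD[OF A])
  define y where "y = adj_mat B *\<^sub>v v"
  have y: "y \<in> carrier_vec k" unfolding y_def using adj_mat(1)[OF B] v by auto
  have By: "B *\<^sub>v y = Determinant.det B \<cdot>\<^sub>v v"
  proof -
    have "B *\<^sub>v y = (B * adj_mat B) *\<^sub>v v"
      unfolding y_def by (rule assoc_mult_mat_vec[symmetric, OF B adj_mat(1)[OF B] v])
    also have "\<dots> = (Determinant.det B \<cdot>\<^sub>m 1\<^sub>m k) *\<^sub>v v" by (simp add: adj_mat(2)[OF B])
    also have "\<dots> = Determinant.det B \<cdot>\<^sub>v (1\<^sub>m k *\<^sub>v v)"
      using v by (intro eq_vecI) auto
    finally show ?thesis using v by simp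
  qed
  define x where "x = Matrix.vec n (\<lambda>j. if j \<in> J then y $ card {a\<in>J. a < j} else 0)"
  have bij: "bij_betw (pick J) {..<k} J"
  proof (rule bij_betw_byWitness[where f' = "\<lambda>j. card {a\<in>J. a < j}"])
    show "(\<lambda>j. card {a\<in>J. a < j}) ` J \<subseteq> {..<k}"
    proof (clarsimp simp: J(2)[symmetric])
      fix j assume "j \<in> J"
      hence "{a\<in>J. a < j} \<subset> J" by blast
      thus "card {a\<in>J. a < j} < card J" by (rule psubset_card_mono[OF fin])
    qed
    show "\<forall>l\<in>{..<k}. card {a\<in>J. a < pick J l} = l"
      by (simp add: card_pick J(2))
    show "\<forall>j\<in>J. pick J (card {a\<in>J. a < j}) = j"
      by (simp add: pick_card_in_set)
    show "pick J ` {..<k} \<subseteq> J"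
      by (simp add: image_subset_iff pick_in_set J(2))
  qed
  have "A *\<^sub>v x = B *\<^sub>v y"
  proof (rule eq_vecI)
    fix i assume "i < dim_vec (B *\<^sub>v y)"
    hence i: "i < k" using B by simp
    have "(A *\<^sub>v x) $ i = (\<Sum>j<n. A $$ (i, j) * x $ j)"
      using i A by (simp add: scalar_prod_def x_def atLeast0LessThan)
    also have "\<dots> = (\<Sum>j\<in>J. A $$ (i, j) * y $ card {a\<in>J. a < j})"
      by (rule sum.mono_neutral_cong_right) (use J in \<open>auto simp: x_def\<close>)
    also have "\<dots> = (\<Sum>l<k. A $$ (i, pick J l) * y $ card {a\<in>J. a < pick J l})"
      by (rule sum.reindex_bij_betw[OF bij, symmetric])
    also have "\<dots> = (\<Sum>l<k. B $$ (i, l) * y $ l)"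
    proof (rule sum.cong)
      fix l assume "l \<in> {..<k}"
      hence l: "l < k" by simp
      have "B $$ (i, l) = A $$ (i, pick J l)"
        unfolding B_def by (subst submatrix_index) (simp_all add: i l pick_UNIV carrier_matD[OF A] Jn J)
      thus "A $$ (i, pick J l) * y $ card {a\<in>J. a < pick J l} = B $$ (i, l) * y $ l"
        using l J(2) by (simp add: card_pick)
    qed simp
    also have "\<dots> = (B *\<^sub>v y) $ i"
      using i B y by (simp add: scalar_prod_def atLeast0LessThan)
    finally show "(A *\<^sub>v x) $ i = (B *\<^sub>v y) $ i" .
  qed (simp add: carrier_matD[OF A] carrier_matD[OF B])
  moreover have "x \<in> carrier_vec n" by (simp add: x_def)
  ultimately show ?thesis
    unfolding mat_image_def B_def[symmetric] By[symmetric] carrier_matD[OF A] by (metis imageI)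
qed

lemma submatrix_map_mat: "submatrix (map_mat h A) UNIV J = map_mat h (submatrix A UNIV J)"
proof (rule eq_matI)
  fix i j assume "i < dim_row (map_mat h (submatrix A UNIV J))" "j < dim_col (map_mat h (submatrix A UNIV J))"
  hence ij: "i < dim_row A" "j < card {j. j < dim_col A \<and> j \<in> J}" by (simp_all add: dim_submatrix)
  have "pick J j < dim_col A" using pick_le[OF ij(2)] .
  thus "submatrix (map_mat h A) UNIV J $$ (i, j) = map_mat h (submatrix A UNIV J) $$ (i, j)"
    using ij by (simp add: submatrix_index dim_submatrix pick_UNIV)
qed (simp_all add: dim_submatrix)

text \<open>
  Selecting the columns of \<open>C\<close> in an arbitrary order \<open>f\<close> differs from the increasing order used by
  \<^const>\<open>submatrix\<close> only by a permutation, so the two determinants agree up to a sign.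
\<close>

lemma row_selection_det_eq_minor:
  fixes C :: "'a::comm_ring_1 mat"
  assumes C: "C \<in> carrier_mat k n"
    and f: "inj_on f {0..<k}" "f ` {0..<k} \<subseteq> {..<n}"
  shows "\<exists>p. p permutes {0..<k} \<and> Determinant.det (mat\<^sub>r k k (\<lambda>i. Matrix.col C (f i)))
    = signof p * Determinant.det (submatrix C UNIV (f ` {0..<k}))"
proof -
  define J where "J = f ` {0..<k}"
  have fin: "finite J" by (simp add: J_def)
  have card: "card J = k" using f by (simp add: J_def card_image)
  have Jn: "{j. j < n \<and> j \<in> J} = J" using f by (auto simp: J_def)
  have S: "submatrix C UNIV J \<in> carrier_mat k k"
    by (rule carrier_matI) (simp_all add: dim_submatrix Jn card carrier_matD[OF C])
  \<comment> \<open>The position of column \<open>f i\<close> in the increasing enumeration of \<open>J\<close>.\<close>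
  define p where "p i = (if i < k then card {a\<in>J. a < f i} else i)" for i
  have pick: "pick J (p i) = f i" if "i < k" for i
    using that by (simp add: p_def pick_card_in_set J_def)
  have p_less: "p i < k" if "i < k" for i
  proof -
    have "{a\<in>J. a < f i} \<subset> J" using that by (auto simp: J_def)
    thus ?thesis using psubset_card_mono[OF fin] card that by (auto simp: p_def)
  qed
  have inj: "inj_on p {0..<k}"
    using f(1) pick by (intro inj_onI) (metis atLeastLessThan_iff inj_onD)
  have perm: "p permutes {0..<k}"
  proof (rule bij_imp_permutes)
    show "bij_betw p {0..<k} {0..<k}"
      unfolding bij_betw_def using inj p_less by (intro conjI endo_inj_surj) auto
  qed (simp add: p_def)
  have "mat\<^sub>r k k (\<lambda>i. Matrix.col C (f i)) = mat k k (\<lambda>(i,j). transpose_mat (submatrix C UNIV J) $$ (p i, j))"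
  proof (rule eq_matI; simp)
    fix i j assume ij: "i < k" "j < k"
    have "f i < n" using subsetD[OF f(2), of "f i"] ij by simp
    moreover have "submatrix C UNIV J $$ (j, p i) = C $$ (j, f i)"
      by (subst submatrix_index) (simp_all add: ij p_less pick pick_UNIV carrier_matD[OF C] Jn card)
    ultimately show "Matrix.col C (f i) $ j = transpose_mat (submatrix C UNIV J) $$ (p i, j)"
      by (simp add: ij p_less carrier_matD[OF C] carrier_matD[OF S])
  qed
  also have "Determinant.det \<dots> = signof p * Determinant.det (transpose_mat (submatrix C UNIV J))"
    by (rule det_permute_rows) (use S perm in auto)
  also have "Determinant.det (transpose_mat (submatrix C UNIV J)) = Determinant.det (submatrix C UNIV J)"
    by (rule det_transpose[OF S])
  finally show ?thesis using perm unfolding J_def by blast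
qed

text \<open>
  Expanding the Gram determinant \<open>det (C C\<^sup>*)\<close> multilinearly gives a combination of maximal minors
  of \<open>C\<close> (the Cauchy-Binet formula), so it vanishes with them. A left null vector \<open>v\<close> of the Gram matrix
  satisfies \<open>\<parallel>v\<^sup>T C\<parallel>\<^sup>2 = 0\<close>, which makes it a left null vector of \<open>C\<close>.
\<close>

lemma minor_zero_left_null_vector:
  fixes C :: "complex mat"
  assumes C: "C \<in> carrier_mat k n"
    and minors: "\<And>J. J \<subseteq> {..<n} \<Longrightarrow> card J = k \<Longrightarrow> Determinant.det (submatrix C UNIV J) = 0"
  obtains w i0 where "i0 < k" "w i0 \<noteq> 0" "\<And>j. j < n \<Longrightarrow> (\<Sum>i<k. w i * C $$ (i, j)) = 0"
proof -
  \<comment> \<open>\<open>M\<close> is the transpose of \<open>C C\<^sup>*\<close>; its rows are linear combinations of the columns of \<open>C\<close>.\<close>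
  define M where "M = mat\<^sub>r k k (\<lambda>i. finsum_vec TYPE(complex) k (\<lambda>j. cnj (C $$ (i, j)) \<cdot>\<^sub>v Matrix.col C j) {..<n})"
  have cv: "Matrix.col C j \<in> carrier_vec k" for j by (rule carrier_vecI) (simp add: carrier_matD[OF C])
  have M_index: "M $$ (i, l) = (\<Sum>j<n. cnj (C $$ (i, j)) * C $$ (l, j))" if "i < k" "l < k" for i l
    unfolding M_def using that cv
    by (simp, subst index_finsum_vec) (simp_all add: Pi_def carrier_matD[OF C])
  have "Determinant.det M = (\<Sum>f | (\<forall>i\<in>{0..<k}. f i \<in> {..<n}) \<and> (\<forall>i. i \<notin> {0..<k} \<longrightarrow> f i = i).
      Determinant.det (mat\<^sub>r k k (\<lambda>i. cnj (C $$ (i, f i)) \<cdot>\<^sub>v Matrix.col C (f i))))"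
    unfolding M_def by (rule det_linear_rows_sum) (use cv in auto)
  also have "\<dots> = 0"
  proof (rule sum.neutral, clarify)
    fix f assume f: "\<forall>i\<in>{0..<k}. f i \<in> {..<n}"
    have "Determinant.det (mat\<^sub>r k k (\<lambda>i. Matrix.col C (f i))) = 0"
    proof (cases "inj_on f {0..<k}")
      case True
      have "Determinant.det (submatrix C UNIV (f ` {0..<k})) = 0"
        using f True by (intro minors) (auto simp: card_image)
      moreover have "f ` {0..<k} \<subseteq> {..<n}" using f by auto
      ultimately show ?thesis using row_selection_det_eq_minor[OF C True] by auto
    next
      case False
      then obtain i j where ij: "i < k" "j < k" "i \<noteq> j" "f i = f j" by (auto simp: inj_on_def)
      show ?thesis
        by (rule det_identical_rows[OF _ ij(3,1,2)]) (use ij cv in auto)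
    qed
    thus "Determinant.det (mat\<^sub>r k k (\<lambda>i. cnj (C $$ (i, f i)) \<cdot>\<^sub>v Matrix.col C (f i))) = 0"
      by (subst det_rows_mul) (use cv in auto)
  qed
  finally have "Determinant.det M = 0" .
  moreover have M: "M \<in> carrier_mat k k" by (simp add: M_def)
  ultimately obtain v where v: "v \<in> carrier_vec k" "v \<noteq> 0\<^sub>v k" "M *\<^sub>v v = 0\<^sub>v k"
    using det_0_iff_vec_prod_zero_field by blast
  define u where "u j = (\<Sum>i<k. v $ i * C $$ (i, j))" for j
  have row0: "(\<Sum>j<n. cnj (C $$ (i, j)) * u j) = 0" if i: "i < k" for i
  proof -
    have "0 = (M *\<^sub>v v) $ i" using v i by simp
    also have "\<dots> = (\<Sum>l<k. \<Sum>j<n. cnj (C $$ (i, j)) * C $$ (l, j) * v $ l)"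
      using M v(1) i by (simp add: scalar_prod_def M_index sum_distrib_right atLeast0LessThan)
    also have "\<dots> = (\<Sum>j<n. \<Sum>l<k. cnj (C $$ (i, j)) * C $$ (l, j) * v $ l)" by (rule sum.swap)
    also have "\<dots> = (\<Sum>j<n. cnj (C $$ (i, j)) * u j)"
      by (simp add: u_def sum_distrib_left mult_ac)
    finally show ?thesis by simp
  qed
  have "complex_of_real (\<Sum>j<n. (norm (u j))\<^sup>2) = (\<Sum>j<n. cnj (u j) * u j)"
    by (simp add: complex_norm_square mult.commute del: of_real_power)
  also have "\<dots> = (\<Sum>j<n. \<Sum>i<k. cnj (v $ i) * (cnj (C $$ (i, j)) * u j))"
    by (simp add: u_def sum_distrib_right sum_distrib_left mult_ac)
  also have "\<dots> = (\<Sum>i<k. cnj (v $ i) * (\<Sum>j<n. cnj (C $$ (i, j)) * u j))"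
    by (subst sum.swap) (simp add: sum_distrib_left)
  also have "\<dots> = 0" by (simp add: row0)
  finally have "(\<Sum>j<n. (norm (u j))\<^sup>2) = 0" using of_real_eq_0_iff by blast
  hence "u j = 0" if "j < n" for j using that by (simp add: sum_nonneg_eq_0_iff)
  moreover obtain i0 where "i0 < k" "v $ i0 \<noteq> 0"
    using v(1,2) by (metis carrier_vecD eq_vecI index_zero_vec)
  ultimately show ?thesis using that[of i0 "\<lambda>i. v $ i"] by (auto simp: u_def)
qed


section \<open>Characters of the cokernel\<close>

definition coker_class :: "'a::comm_ring_1 mat \<Rightarrow> 'a Matrix.vec \<Rightarrow> 'a Matrix.vec set"
  where "coker_class A v = mat_image A +>\<^bsub>module_vec TYPE('a) (dim_row A)\<^esub> v"

lemma submodule_mat_image: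
  fixes A :: "'a::comm_ring_1 mat"
  shows "Module.submodule (mat_image A) class_ring (module_vec TYPE('a) (dim_row A))"
    and "module class_ring (module_vec TYPE('a) (dim_row A))"
proof -
  let ?V = "module_vec TYPE('a) (dim_row A)"
  interpret vec_module "TYPE('a)" "dim_row A" .
  show mod: "module class_ring ?V" by unfold_locales
  have in_carrier: "A *\<^sub>v x \<in> carrier_vec (dim_row A)" for x
    by (rule carrier_vecI) simp
  have scale: "r \<cdot>\<^sub>v a \<in> mat_image A" if a: "a \<in> mat_image A" for r a
  proof -
    obtain x where x: "x \<in> carrier_vec (dim_col A)" "a = A *\<^sub>v x" using a by (auto simp: mat_image_def)
    have "r \<cdot>\<^sub>v a = A *\<^sub>v (r \<cdot>\<^sub>v x)"
      using x by (intro eq_vecI) auto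
    thus ?thesis using x by (auto simp: mat_image_def)
  qed
  show "Module.submodule (mat_image A) class_ring ?V"
  proof (rule Module.module.submoduleI[OF mod])
    show "mat_image A \<subseteq> carrier ?V"
      using in_carrier by (auto simp: mat_image_def module_vec_simps)
    show "\<zero>\<^bsub>?V\<^esub> \<in> mat_image A"
      by (auto simp: mat_image_def module_vec_simps intro!: image_eqI[of _ _ "0\<^sub>v (dim_col A)"])
    fix a assume a: "a \<in> mat_image A"
    show "r \<odot>\<^bsub>?V\<^esub> a \<in> mat_image A" for r
      using scale[OF a] by (simp add: module_vec_simps)
    have a': "a \<in> carrier_vec (dim_row A)" using a in_carrier by (auto simp: mat_image_def)
    have "\<ominus>\<^bsub>?V\<^esub> a = (- 1) \<cdot>\<^sub>v a"
      by (rule M.minus_equality) (use a' in \<open>auto simp: module_vec_simps intro!: eq_vecI\<close>)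
    thus "\<ominus>\<^bsub>?V\<^esub> a \<in> mat_image A" using scale[OF a] by simp
    fix b assume b: "b \<in> mat_image A"
    obtain x y where "x \<in> carrier_vec (dim_col A)" "y \<in> carrier_vec (dim_col A)" "a = A *\<^sub>v x" "b = A *\<^sub>v y"
      using a b by (auto simp: mat_image_def)
    thus "a \<oplus>\<^bsub>?V\<^esub> b \<in> mat_image A"
      unfolding mat_image_def module_vec_simps
      using mult_add_distrib_mat_vec[of A "dim_row A" "dim_col A" x y] by (auto intro!: image_eqI[of _ _ "x + y"])
  qed
qed

lemma coker_module_facts:
  fixes A :: "'a::comm_ring_1 mat"
  assumes A: "A \<in> carrier_mat k n"
  shows carrier_coker: "carrier (coker_module A) = coker_class A ` carrier_vec k"
    and coker_class_add: "v \<in> carrier_vec k \<Longrightarrow> w \<in> carrier_vec k \<Longrightarrow>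
      coker_class A v \<oplus>\<^bsub>coker_module A\<^esub> coker_class A w = coker_class A (v + w)"
    and coker_class_smult: "v \<in> carrier_vec k \<Longrightarrow>
      r \<odot>\<^bsub>coker_module A\<^esub> coker_class A v = coker_class A (r \<cdot>\<^sub>v v)"
    and coker_class_mat_image: "v \<in> mat_image A \<Longrightarrow> coker_class A v = coker_class A (0\<^sub>v k)"
    and coker_class_eqD: "v \<in> carrier_vec k \<Longrightarrow> coker_class A v = coker_class A w \<Longrightarrow> \<exists>h\<in>mat_image A. v = h + w"
    and mat_image_carrier: "mat_image A \<subseteq> carrier_vec k"
proof -
  let ?V = "module_vec TYPE('a) (dim_row A)"
  have dr: "dim_row A = k" using A by simp
  note sub = submodule_mat_image(2,1)[of A]
  interpret abelian_subgroup "mat_image A" ?V using submodule_abelian_subgroup[OF sub] .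
  show "carrier (coker_module A) = coker_class A ` carrier_vec k"
    unfolding coker_module_def quot_module_simps A_RCOSETS_def' by (auto simp: coker_class_def module_vec_simps dr)
  show "coker_class A v \<oplus>\<^bsub>coker_module A\<^esub> coker_class A w = coker_class A (v + w)"
    if "v \<in> carrier_vec k" "w \<in> carrier_vec k"
    using that a_rcos_sum[of v w] by (simp add: coker_module_def quot_module_simps coker_class_def module_vec_simps dr)
  show "r \<odot>\<^bsub>coker_module A\<^esub> coker_class A v = coker_class A (r \<cdot>\<^sub>v v)" if "v \<in> carrier_vec k"
    using that quot_module_smult[OF sub, of r v] by (simp add: coker_module_def coker_class_def module_vec_simps dr)
  have zero: "0\<^sub>v k \<in> mat_image A"
    using additive_subgroup.zero_closed[OF additive_subgroup_axioms] by (simp add: module_vec_simps dr)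
  show "coker_class A v = coker_class A (0\<^sub>v k)" if "v \<in> mat_image A"
    unfolding coker_class_def a_rcos_const[OF that] a_rcos_const[OF zero] ..
  show "\<exists>h\<in>mat_image A. v = h + w" if "v \<in> carrier_vec k" "coker_class A v = coker_class A w"
  proof -
    have "v \<in> coker_class A v" using that(1) a_rcos_self[of v] by (simp add: coker_class_def module_vec_simps dr)
    hence "v \<in> coker_class A w" by (simp only: that(2))
    thus ?thesis unfolding coker_class_def a_r_coset_iff by (simp add: module_vec_simps)
  qed
  show "mat_image A \<subseteq> carrier_vec k" using a_subset by (simp add: module_vec_simps dr)
qed

text \<open>
  A character of \<open>R\<^sup>k\<close> that is trivial on the image of \<open>A\<close> is constant on its cosets, hence descends
  to the cokernel. By lemma \<open>dual_coker\<close> every character of the cokernel arises in this way.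
\<close>

lemma coker_character_exists:
  fixes A :: "'a::comm_ring_1 mat"
  assumes A: "A \<in> carrier_mat k n"
    and norm: "\<And>v. v \<in> carrier_vec k \<Longrightarrow> norm (\<psi> v) = 1"
    and mult: "\<And>v w. v \<in> carrier_vec k \<Longrightarrow> w \<in> carrier_vec k \<Longrightarrow> \<psi> (v + w) = \<psi> v * \<psi> w"
    and triv: "\<And>v. v \<in> mat_image A \<Longrightarrow> \<psi> v = 1"
  obtains \<phi> where "\<phi> \<in> carrier (dual_group (coker_module A))"
    "\<And>v. v \<in> carrier_vec k \<Longrightarrow> \<phi> (coker_class A v) = \<psi> v"
proof -
  define \<phi> where "\<phi> = (\<lambda>C\<in>carrier (coker_module A). \<psi> (SOME v. v \<in> carrier_vec k \<and> coker_class A v = C))"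
  have eq: "\<phi> (coker_class A v) = \<psi> v" if v: "v \<in> carrier_vec k" for v
  proof -
    define u where "u = (SOME u. u \<in> carrier_vec k \<and> coker_class A u = coker_class A v)"
    have u: "u \<in> carrier_vec k" "coker_class A u = coker_class A v"
      unfolding u_def by (rule someI2[of _ v]; use v in auto)+
    obtain h where h: "h \<in> mat_image A" "u = h + v" using coker_class_eqD[OF A u] by blast
    have "h \<in> carrier_vec k" using h mat_image_carrier[OF A] by auto
    hence "\<psi> u = \<psi> v" using h v by (simp add: mult triv)
    thus ?thesis using v by (simp add: \<phi>_def carrier_coker[OF A] u_def)
  qed
  have "\<phi> \<in> carrier (dual_group (coker_module A))"
    unfolding dual_group_simps
    by (auto simp: carrier_coker[OF A] coker_class_add[OF A] eq mult norm)
       (auto simp: \<phi>_def carrier_coker[OF A])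
  thus ?thesis using that eq by blast
qed

lemma dual_coker:
  fixes A :: "'a::comm_ring_1 mat"
  assumes A: "A \<in> carrier_mat k n" and \<phi>: "\<phi> \<in> carrier (dual_group (coker_module A))"
  shows dual_coker_norm: "v \<in> carrier_vec k \<Longrightarrow> norm (\<phi> (coker_class A v)) = 1"
    and dual_coker_add: "v \<in> carrier_vec k \<Longrightarrow> w \<in> carrier_vec k \<Longrightarrow>
      \<phi> (coker_class A (v + w)) = \<phi> (coker_class A v) * \<phi> (coker_class A w)"
    and dual_coker_mat_image: "v \<in> mat_image A \<Longrightarrow> \<phi> (coker_class A v) = 1"
proof -
  show n: "norm (\<phi> (coker_class A v)) = 1" if "v \<in> carrier_vec k" for v
    using \<phi> that by (auto simp: dual_group_simps carrier_coker[OF A] PiE_iff)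
  show m: "\<phi> (coker_class A (v + w)) = \<phi> (coker_class A v) * \<phi> (coker_class A w)"
    if "v \<in> carrier_vec k" "w \<in> carrier_vec k" for v w
    using \<phi> that by (auto simp: dual_group_simps carrier_coker[OF A] coker_class_add[OF A])
  show "\<phi> (coker_class A v) = 1" if v: "v \<in> mat_image A"
  proof -
    let ?z = "\<phi> (coker_class A (0\<^sub>v k))"
    have "?z = ?z * ?z" using m[of "0\<^sub>v k" "0\<^sub>v k"] by simp
    moreover have "?z \<noteq> 0" using n[of "0\<^sub>v k"] by auto
    ultimately show ?thesis by (simp add: coker_class_mat_image[OF A v])
  qed
qed

lemma dual_action_closed:
  "\<phi> \<in> carrier (dual_group (coker_module A)) \<Longrightarrow> dual_action (coker_module A) m \<phi> \<in> carrier (dual_group (coker_module A))"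
  using dual_action_automorphisms(1)[OF module_coker_module] by (auto simp: hom_def Pi_iff)

lemma dual_action_coker_class:
  assumes A: "A \<in> carrier_mat k n" and v: "v \<in> carrier_vec k"
  shows "dual_action (coker_module A) m \<phi> (coker_class A v) = \<phi> (coker_class A (umonom m \<cdot>\<^sub>v v))"
  using v by (simp add: dual_action_def carrier_coker[OF A] coker_class_smult[OF A])

lemma dual_action_cancel:
  assumes "\<phi> \<in> carrier (dual_group (coker_module A))"
  shows "dual_action (coker_module A) m (dual_action (coker_module A) (- m) \<phi>) = \<phi>"
  using dual_action_automorphisms(3,4)[OF module_coker_module assms] by (metis add.right_inverse)

lemma one_dual_coker:
  assumes A: "A \<in> carrier_mat k n"
  shows "\<phi> \<in> carrier (dual_group (coker_module A)) \<Longrightarrow>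
    (\<And>v. v \<in> carrier_vec k \<Longrightarrow> \<phi> (coker_class A v) = 1) \<Longrightarrow> \<phi> = \<one>\<^bsub>dual_group (coker_module A)\<^esub>"
    and "v \<in> carrier_vec k \<Longrightarrow> \<one>\<^bsub>dual_group (coker_module A)\<^esub> (coker_class A v) = 1"
  by (auto simp: dual_group_simps carrier_coker[OF A] PiE_iff extensional_def fun_eq_iff restrict_def)


section \<open>Points of the circle near one\<close>

lemma norm_cis_minus_1_le: "norm (cis x - 1) \<le> \<bar>x\<bar>"
  using dist_exp_i_1[of x] abs_sin_x_le_abs_x[of "x / 2"] by (simp add: cis_conv_exp)

text \<open>
  This is the step from congruence modulo \<open>2\<pi>\<close> to equality: linear combinations of sufficiently small
  arguments that are trivial on the circle are trivial in \<open>\<real>\<close>.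
\<close>

lemma cis_eq_1_imp_0:
  assumes "cis x = 1" "\<bar>x\<bar> < 2 * pi"
  shows "x = 0"
proof -
  have "cos x = 1" using assms(1) by (simp add: complex_eq_iff)
  then obtain m :: int where m: "x = of_int m * 2 * pi" using cos_one_2pi_int by blast
  hence "\<bar>real_of_int m\<bar> * (2 * pi) < 1 * (2 * pi)" using assms(2) by (simp add: abs_mult)
  hence "\<bar>real_of_int m\<bar> < 1" by (rule mult_right_less_imp_less) simp
  hence "m = 0" by linarith
  thus ?thesis using m by simp
qed

lemma nbhd_Arg_small:
  assumes "\<eta> > 0"
  obtains \<delta> where "\<delta> > 0" "\<And>z. norm (z - 1) < \<delta> \<Longrightarrow> \<bar>Arg z\<bar> < \<eta>"
proof -
  have "continuous (at 1) Arg" by (rule continuous_at_Arg) (auto simp: complex_nonpos_Reals_iff)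
  then obtain \<delta> where "\<delta> > 0" "\<forall>z. dist z 1 < \<delta> \<longrightarrow> dist (Arg z) (Arg 1) < \<eta>"
    unfolding continuous_at_eps_delta using assms by blast
  thus ?thesis using that[of \<delta>] by (simp add: dist_norm)
qed


section \<open>A common zero of the minors destroys expansiveness\<close>

text \<open>
  The functional \<open>P\<close> below is the pairing with the null vector after evaluation at \<open>z\<close>. Its modulus is
  invariant under the shifts \<open>v \<mapsto> u\<^sup>m v\<close>, so on the finitely many classes that define a basic
  neighbourhood of the identity, all shifts of \<open>cis (e * Re P)\<close> are uniformly close to \<open>1\<close> when \<open>e\<close> is
  small.
\<close>

lemma not_expansive_if_left_null:
  fixes A :: "'d::{finite,linorder} laurent mat"
  assumes A: "A \<in> carrier_mat k n" and z: "z \<in> unit_torus"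
    and w: "i0 < k" "w i0 \<noteq> 0" "\<And>j. j < n \<Longrightarrow> (\<Sum>i<k. w i * laurent_eval (A $$ (i, j)) z) = 0"
  shows "\<not> expansive (dual_topology (coker_module A)) (dual_group (coker_module A))
      (dual_action (coker_module A))"
proof
  let ?Q = "coker_module A"
  interpret ev: comm_ring_hom "\<lambda>f. laurent_eval f z" by (rule comm_ring_hom_eval[OF z])
  \<comment> \<open>Dividing by \<open>w i0\<close> makes \<open>P\<close> equal to \<open>1\<close> on a unit vector, which later shows that the
    character is not trivial.\<close>
  define P where "P v = (\<Sum>i<k. (w i / w i0) * laurent_eval (v $ i) z)" for v
  have P_add: "P (v + v') = P v + P v'" if "v \<in> carrier_vec k" "v' \<in> carrier_vec k" for v v'
    unfolding P_def sum.distrib[symmetric] using that by (intro sum.cong refl) (simp add: ev.hom_add distrib_left)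
  have P_smult: "P (r \<cdot>\<^sub>v v) = laurent_eval r z * P v" if "v \<in> carrier_vec k" for r v
    unfolding P_def sum_distrib_left using that by (intro sum.cong refl) (simp add: ev.hom_mult)
  have P_image: "P v = 0" if v: "v \<in> mat_image A" for v
  proof -
    obtain x where x: "x \<in> carrier_vec n" "v = A *\<^sub>v x" using v A by (auto simp: mat_image_def)
    have "P v = (\<Sum>i<k. \<Sum>j<n. (w i / w i0) * laurent_eval (A $$ (i, j)) z * laurent_eval (x $ j) z)"
      unfolding P_def
    proof (intro sum.cong refl)
      fix i assume "i \<in> {..<k}"
      hence "v $ i = (\<Sum>j<n. A $$ (i, j) * x $ j)"
        using x A by (simp add: scalar_prod_def atLeast0LessThan)
      thus "(w i / w i0) * laurent_eval (v $ i) z =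
          (\<Sum>j<n. (w i / w i0) * laurent_eval (A $$ (i, j)) z * laurent_eval (x $ j) z)"
        by (simp add: ev.hom_sum ev.hom_mult sum_distrib_left mult.assoc)
    qed
    also have "\<dots> = (\<Sum>j<n. (laurent_eval (x $ j) z / w i0) * (\<Sum>i<k. w i * laurent_eval (A $$ (i, j)) z))"
      by (subst sum.swap) (simp add: sum_distrib_left mult_ac divide_inverse)
    also have "\<dots> = 0" by (simp add: w(3))
    finally show ?thesis .
  qed
  have P_unit: "P (unit_vec k i0) = 1"
  proof -
    have "P (unit_vec k i0) = (\<Sum>i<k. if i = i0 then w i / w i0 else 0)"
      unfolding P_def by (intro sum.cong refl) (simp add: w(1))
    thus ?thesis using w by simp
  qed
  define \<psi> where "\<psi> e v = cis (e * Re (P v))" for e v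
  have \<psi>_near: "norm (\<psi> e (umonom m \<cdot>\<^sub>v v) - 1) \<le> e * norm (P v)" if "e > 0" "v \<in> carrier_vec k" for e m v
  proof -
    have "norm (P (umonom m \<cdot>\<^sub>v v)) = norm (P v)"
      using that by (simp add: P_smult norm_mult norm_char_at[OF z])
    hence "\<bar>Re (P (umonom m \<cdot>\<^sub>v v))\<bar> \<le> norm (P v)" using abs_Re_le_cmod by metis
    moreover have "norm (\<psi> e (umonom m \<cdot>\<^sub>v v) - 1) \<le> e * \<bar>Re (P (umonom m \<cdot>\<^sub>v v))\<bar>"
      using norm_cis_minus_1_le[of "e * Re (P (umonom m \<cdot>\<^sub>v v))"] that by (simp add: \<psi>_def abs_mult)
    ultimately show ?thesis using that by (meson mult_left_mono order_trans less_imp_le)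
  qed
  assume "expansive (dual_topology ?Q) (dual_group ?Q) (dual_action ?Q)"
  then obtain N U where U: "openin (dual_topology ?Q) U" "\<one>\<^bsub>dual_group ?Q\<^esub> \<in> U" "U \<subseteq> N"
    and N: "(\<Inter>m. dual_action ?Q m ` N) = {\<one>\<^bsub>dual_group ?Q\<^esub>}"
    unfolding expansive_def by blast
  obtain T where T: "openin (product_topology (\<lambda>_. top_of_set (sphere 0 1)) (carrier ?Q)) T"
    "U = T \<inter> carrier (dual_group ?Q)"
    using U(1) unfolding dual_topology_def openin_subtopology by blast
  obtain W where W: "finite {C \<in> carrier ?Q. W C \<noteq> sphere (0::complex) 1}"
    "\<And>C. C \<in> carrier ?Q \<Longrightarrow> openin (top_of_set (sphere 0 1)) (W C)"
    "\<one>\<^bsub>dual_group ?Q\<^esub> \<in> Pi\<^sub>E (carrier ?Q) W" "Pi\<^sub>E (carrier ?Q) W \<subseteq> T"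
    using T U(2) unfolding openin_product_topology_alt by (auto dest!: bspec[of T _ "\<one>\<^bsub>dual_group ?Q\<^esub>"])
  have "\<forall>\<^sub>F e in at_right 0. \<forall>C\<in>{C \<in> carrier ?Q. W C \<noteq> sphere 0 1}.
      \<forall>v\<in>carrier_vec k. \<forall>m. C = coker_class A v \<longrightarrow> \<psi> e (umonom m \<cdot>\<^sub>v v) \<in> W C"
  proof (rule eventually_ball_finite[OF W(1)], rule ballI)
    fix C assume "C \<in> {C \<in> carrier ?Q. W C \<noteq> sphere 0 1}"
    hence C: "C \<in> carrier ?Q" by simp
    have "1 \<in> W C" using W(3) C by (auto simp: PiE_iff dual_group_simps)
    then obtain \<delta> where \<delta>: "\<delta> > 0" "\<And>x. norm x = 1 \<Longrightarrow> norm (x - 1) < \<delta> \<Longrightarrow> x \<in> W C"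
      using W(2)[OF C] unfolding openin_euclidean_subtopology_iff by (auto simp: dist_norm)
    obtain u where u: "u \<in> carrier_vec k" "C = coker_class A u" using C carrier_coker[OF A] by auto
    have Pu: "P v = P u" if v: "v \<in> carrier_vec k" "C = coker_class A v" for v
    proof -
      obtain h where h: "h \<in> mat_image A" "v = h + u"
        using coker_class_eqD[OF A v(1), of u] u v by auto
      thus ?thesis using P_add[of h u] P_image[of h] mat_image_carrier[OF A] u by auto
    qed
    have "((\<lambda>e. e * norm (P u)) \<longlongrightarrow> 0 * norm (P u)) (at_right 0)"
      by (intro tendsto_intros)
    hence "\<forall>\<^sub>F e in at_right 0. e * norm (P u) < \<delta>"
      using \<delta>(1) by (intro order_tendstoD) auto
    moreover have "\<forall>\<^sub>F e::real in at_right 0. e > 0" by (simp add: eventually_at_right_less)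
    ultimately show "\<forall>\<^sub>F e in at_right 0. \<forall>v\<in>carrier_vec k. \<forall>m. C = coker_class A v \<longrightarrow> \<psi> e (umonom m \<cdot>\<^sub>v v) \<in> W C"
    proof eventually_elim
      case (elim e)
      show ?case
      proof (intro ballI allI impI)
        fix v m assume v: "v \<in> carrier_vec k" "C = coker_class A v"
        have "norm (\<psi> e (umonom m \<cdot>\<^sub>v v) - 1) < \<delta>"
          using \<psi>_near[OF elim(2) v(1), of m] elim(1) Pu[OF v] by simp
        thus "\<psi> e (umonom m \<cdot>\<^sub>v v) \<in> W C" by (intro \<delta>(2)) (simp_all add: \<psi>_def)
      qed
    qed
  qed
  moreover have "\<forall>\<^sub>F e::real in at_right 0. e > 0" by (simp add: eventually_at_right_less)
  moreover have "\<forall>\<^sub>F e::real in at_right 0. e < 1"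
    by (rule order_tendstoD[OF tendsto_ident_at]) simp
  ultimately have "\<forall>\<^sub>F e in at_right (0::real). 0 < e \<and> e < 1 \<and> (\<forall>C\<in>{C \<in> carrier ?Q. W C \<noteq> sphere 0 1}.
      \<forall>v\<in>carrier_vec k. \<forall>m. C = coker_class A v \<longrightarrow> \<psi> e (umonom m \<cdot>\<^sub>v v) \<in> W C)"
    by eventually_elim blast
  from eventually_happens'[OF trivial_limit_at_right_real this]
  obtain e where e: "0 < e" "e < 1" and small: "\<forall>C\<in>{C \<in> carrier ?Q. W C \<noteq> sphere 0 1}.
      \<forall>v\<in>carrier_vec k. \<forall>m. C = coker_class A v \<longrightarrow> \<psi> e (umonom m \<cdot>\<^sub>v v) \<in> W C"
    by blast
  have in_W: "\<psi> e (umonom m \<cdot>\<^sub>v v) \<in> W (coker_class A v)"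
    if "v \<in> carrier_vec k" "W (coker_class A v) \<noteq> sphere 0 1" for v m
  proof -
    have "coker_class A v \<in> {C \<in> carrier ?Q. W C \<noteq> sphere 0 1}"
      using that carrier_coker[OF A] by simp
    from bspec[OF bspec[OF small this] that(1)] show ?thesis by simp
  qed
  obtain \<phi> where \<phi>: "\<phi> \<in> carrier (dual_group ?Q)" "\<And>v. v \<in> carrier_vec k \<Longrightarrow> \<phi> (coker_class A v) = \<psi> e v"
  proof (rule coker_character_exists[OF A, of "\<psi> e"])
    show "\<psi> e (v + v') = \<psi> e v * \<psi> e v'" if "v \<in> carrier_vec k" "v' \<in> carrier_vec k" for v v'
      using that by (simp add: \<psi>_def P_add cis_mult distrib_left)
  qed (auto simp: \<psi>_def P_image)
  have "dual_action ?Q m \<phi> \<in> U" for m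
  proof -
    have "dual_action ?Q m \<phi> \<in> Pi\<^sub>E (carrier ?Q) W"
    proof (rule PiE_I)
      fix C assume "C \<in> carrier ?Q"
      then obtain v where v: "v \<in> carrier_vec k" "C = coker_class A v" using carrier_coker[OF A] by auto
      have "dual_action ?Q m \<phi> C = \<psi> e (umonom m \<cdot>\<^sub>v v)"
        using v by (simp add: dual_action_coker_class[OF A] \<phi>(2))
      moreover have "norm (\<psi> e (umonom m \<cdot>\<^sub>v v)) = 1" by (simp add: \<psi>_def)
      ultimately show "dual_action ?Q m \<phi> C \<in> W C"
        using in_W[OF v(1), of m] v by (cases "W C = sphere 0 1") auto
    qed (simp add: dual_action_def)
    thus ?thesis using W(4) T(2) dual_action_closed[OF \<phi>(1)] by auto
  qed
  hence "\<phi> \<in> dual_action ?Q m ` N" for m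
    using U(3) dual_action_cancel[OF \<phi>(1), of m] by (metis imageI subsetD)
  hence "\<phi> = \<one>\<^bsub>dual_group ?Q\<^esub>" using N by auto
  hence "\<psi> e (unit_vec k i0) = 1"
    using \<phi>(2)[of "unit_vec k i0"] one_dual_coker(2)[OF A, of "unit_vec k i0"] by simp
  hence "e = 0" using e pi_gt3 by (intro cis_eq_1_imp_0) (auto simp: \<psi>_def P_unit)
  thus False using e by simp
qed


section \<open>Expansiveness from minors without common zero\<close>

lemma openin_character_near_one:
  assumes A: "A \<in> carrier_mat k n"
  shows "openin (dual_topology (coker_module A))
    {\<phi> \<in> carrier (dual_group (coker_module A)). \<forall>i<k. norm (\<phi> (coker_class A (unit_vec k i)) - 1) < \<delta>}"
proof -
  let ?Q = "coker_module A"
  have cont: "continuous_map (dual_topology ?Q) euclidean (\<lambda>\<phi>. \<phi> C)" if "C \<in> carrier ?Q" for C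
    using continuous_map_product_projection[OF that, of "\<lambda>_. top_of_set (sphere 0 1)"]
    unfolding dual_topology_def continuous_map_in_subtopology by (blast intro: continuous_map_from_subtopology)
  have "openin (dual_topology ?Q) {\<phi> \<in> topspace (dual_topology ?Q). \<phi> (coker_class A (unit_vec k i)) \<in> ball 1 \<delta>}"
    if "i < k" for i
    by (rule openin_continuous_map_preimage[OF cont]) (simp_all add: carrier_coker[OF A])
  hence "openin (dual_topology ?Q) ((\<Inter>i\<in>{..<k}.
      {\<phi> \<in> topspace (dual_topology ?Q). \<phi> (coker_class A (unit_vec k i)) \<in> ball 1 \<delta>}) \<inter> topspace (dual_topology ?Q))"
    by (intro openin_INT) auto
  also have "(\<Inter>i\<in>{..<k}. {\<phi> \<in> topspace (dual_topology ?Q). \<phi> (coker_class A (unit_vec k i)) \<in> ball 1 \<delta>})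
      \<inter> topspace (dual_topology ?Q) =
    {\<phi> \<in> carrier (dual_group ?Q). \<forall>i<k. norm (\<phi> (coker_class A (unit_vec k i)) - 1) < \<delta>}"
    by (auto simp: topspace_dual_topology dist_norm norm_minus_commute)
  finally show ?thesis .
qed

text \<open>
  The lift \<open>\<tau>\<close> of \<open>\<phi>\<close> to real-valued additive maps turns the relations given by the columns of
  \<open>A\<close> into exact linear equations, because \<open>\<eta>\<close> times the total \<open>\<ell>\<^sup>1\<close>-norm of \<open>A\<close> is at most
  \<open>1 < 2 * pi\<close>. Hence the lift kills the image of \<open>A\<close>, so its components kill the ideal of maximal minors,
  and vanish by lemma \<open>bounded_additive_eq_0\<close>.
\<close>

lemma character_eq_1_if_small:
  fixes A :: "'d::{finite,linorder} laurent mat"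
  assumes A: "A \<in> carrier_mat k n" and \<phi>: "\<phi> \<in> carrier (dual_group (coker_module A))"
    and \<eta>: "\<eta> > 0" "\<eta> * real_of_int (\<Sum>i<k. \<Sum>j<n. coeff_norm (A $$ (i, j))) \<le> 1"
    and small: "\<And>i m. i < k \<Longrightarrow> \<bar>Arg (\<phi> (coker_class A (umonom m \<cdot>\<^sub>v unit_vec k i)))\<bar> < \<eta>"
    and nz: "\<And>z. z \<in> unit_torus \<Longrightarrow> \<exists>J. J \<subseteq> {..<n} \<and> card J = k \<and>
      laurent_eval (Determinant.det (submatrix A UNIV J)) z \<noteq> 0"
  shows "\<phi> = \<one>\<^bsub>dual_group (coker_module A)\<^esub>"
proof -
  define \<chi> where "\<chi> v = \<phi> (coker_class A v)" for v
  note \<chi>_norm = dual_coker_norm[OF A \<phi>, folded \<chi>_def]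
    and \<chi>_add = dual_coker_add[OF A \<phi>, folded \<chi>_def]
    and \<chi>_image = dual_coker_mat_image[OF A \<phi>, folded \<chi>_def]
  have zero_image: "0\<^sub>v k \<in> mat_image A"
    unfolding mat_image_def using A by (auto intro!: image_eqI[of _ _ "0\<^sub>v n"])
  define \<tau> where "\<tau> i = lin_ext (\<lambda>m. Arg (\<chi> (umonom m \<cdot>\<^sub>v unit_vec k i)))" for i
  have add_\<tau>: "additive (\<tau> i)" for i unfolding \<tau>_def by (rule additive_lin_ext)
  have \<tau>_small: "\<bar>\<tau> i (umonom m)\<bar> \<le> \<eta>" if "i < k" for i m
    using small[OF that, of m] by (simp add: \<tau>_def \<chi>_def)
  have \<chi>_comp: "\<chi> (g \<cdot>\<^sub>v unit_vec k i) = cis (\<tau> i g)" if i: "i < k" for i g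
  proof (induction g rule: laurent_induct)
    case zero
    have "(0 :: 'd laurent) \<cdot>\<^sub>v unit_vec k i = 0\<^sub>v k" by (intro eq_vecI) auto
    thus ?case by (simp add: additive.zero[OF add_\<tau>] \<chi>_image zero_image)
  next
    case (umonom m)
    have "norm (\<chi> (umonom m \<cdot>\<^sub>v unit_vec k i)) = 1" by (rule \<chi>_norm) simp
    moreover from this have "\<chi> (umonom m \<cdot>\<^sub>v unit_vec k i) \<noteq> 0" by auto
    ultimately show ?case by (simp add: \<tau>_def cis_Arg sgn_div_norm)
  next
    case (diff f g)
    have "(f - g) \<cdot>\<^sub>v unit_vec k i + g \<cdot>\<^sub>v unit_vec k i = f \<cdot>\<^sub>v unit_vec k i"
      by (intro eq_vecI) (auto simp: algebra_simps)
    hence "\<chi> ((f - g) \<cdot>\<^sub>v unit_vec k i) * cis (\<tau> i g) = cis (\<tau> i f)"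
      using \<chi>_add[of "(f - g) \<cdot>\<^sub>v unit_vec k i" "g \<cdot>\<^sub>v unit_vec k i"] diff by simp
    hence "\<chi> ((f - g) \<cdot>\<^sub>v unit_vec k i) = cis (\<tau> i f) / cis (\<tau> i g)"
      by (simp add: eq_divide_eq)
    thus ?case by (simp add: cis_divide additive.diff[OF add_\<tau>])
  qed
  have \<chi>_eq: "\<chi> v = cis (\<Sum>i<k. \<tau> i (v $ i))" if v: "v \<in> carrier_vec k" for v
  proof -
    have prefix: "\<chi> (Matrix.vec k (\<lambda>i. if i < r then v $ i else 0)) = cis (\<Sum>i<r. \<tau> i (v $ i))" if "r \<le> k" for r
      using that
    proof (induction r)
      case 0
      have "Matrix.vec k (\<lambda>i. if i < 0 then v $ i else 0) = 0\<^sub>v k" by (intro eq_vecI) auto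
      thus ?case by (simp add: \<chi>_image zero_image)
    next
      case (Suc r)
      have "Matrix.vec k (\<lambda>i. if i < Suc r then v $ i else 0) =
          Matrix.vec k (\<lambda>i. if i < r then v $ i else 0) + v $ r \<cdot>\<^sub>v unit_vec k r"
        using Suc.prems by (intro eq_vecI) (auto simp: less_Suc_eq)
      thus ?case using Suc by (simp add: \<chi>_add \<chi>_comp cis_mult)
    qed
    have "Matrix.vec k (\<lambda>i. if i < k then v $ i else 0) = v" using v by (intro eq_vecI) auto
    with prefix[OF order_refl] show ?thesis by (simp only:)
  qed
  have column: "(\<Sum>i<k. \<tau> i (A $$ (i, j) * g)) = 0" if j: "j < n" for j g
  proof -
    have "(\<Sum>i<k. \<tau> i (A $$ (i, j) * umonom m)) = 0" for m
    proof (rule cis_eq_1_imp_0)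
      have "A *\<^sub>v (umonom m \<cdot>\<^sub>v unit_vec n j) \<in> mat_image A"
        unfolding mat_image_def carrier_matD[OF A] by (rule imageI) simp
      moreover have "(A *\<^sub>v (umonom m \<cdot>\<^sub>v unit_vec n j)) $ i = A $$ (i, j) * umonom m" if "i < k" for i
      proof -
        have "(A *\<^sub>v (umonom m \<cdot>\<^sub>v unit_vec n j)) $ i =
            (\<Sum>l<n. A $$ (i, l) * (umonom m * (if l = j then 1 else 0)))"
          using that j by (simp add: scalar_prod_def atLeast0LessThan carrier_matD[OF A])
        also have "\<dots> = A $$ (i, j) * umonom m"
          using j by (subst sum.remove[of _ j]) auto
        finally show ?thesis .
      qed
      ultimately show "cis (\<Sum>i<k. \<tau> i (A $$ (i, j) * umonom m)) = 1"
        using \<chi>_eq[of "A *\<^sub>v (umonom m \<cdot>\<^sub>v unit_vec n j)"] \<chi>_image mat_image_carrier[OF A] by auto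
      have "\<bar>\<Sum>i<k. \<tau> i (A $$ (i, j) * umonom m)\<bar> \<le> (\<Sum>i<k. \<bar>\<tau> i (A $$ (i, j) * umonom m)\<bar>)"
        by (rule sum_abs)
      also have "\<dots> \<le> (\<Sum>i<k. \<eta> * real_of_int (coeff_norm (A $$ (i, j))))"
      proof (intro sum_mono)
        fix i assume "i \<in> {..<k}"
        hence i: "i < k" by simp
        show "\<bar>\<tau> i (A $$ (i, j) * umonom m)\<bar> \<le> \<eta> * real_of_int (coeff_norm (A $$ (i, j)))"
          using additive_bound[OF additive_mult_right[OF add_\<tau>], of i "umonom m" \<eta> "A $$ (i, j)"] \<tau>_small[OF i]
          by (simp flip: umonom_add)
      qed
      also have "\<dots> = \<eta> * real_of_int (\<Sum>i<k. coeff_norm (A $$ (i, j)))" by (simp add: sum_distrib_left)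
      also have "\<dots> \<le> \<eta> * real_of_int (\<Sum>i<k. \<Sum>j<n. coeff_norm (A $$ (i, j)))"
        using \<eta>(1) j by (intro mult_left_mono of_int_le_iff[THEN iffD2] sum_mono member_le_sum coeff_norm_nonneg) auto
      also have "\<dots> < 2 * pi" using \<eta>(2) pi_gt3 by linarith
      finally show "\<bar>\<Sum>i<k. \<tau> i (A $$ (i, j) * umonom m)\<bar> < 2 * pi" .
    qed
    moreover have "additive (\<lambda>g. \<Sum>i<k. \<tau> i (A $$ (i, j) * g))"
      by (simp add: additive_def distrib_left additive.add[OF add_\<tau>] sum.distrib)
    moreover have "additive (\<lambda>_::'d laurent. 0::real)" by (simp add: additive_def)
    ultimately show ?thesis
      using additive_laurent_eqI[of "\<lambda>g. \<Sum>i<k. \<tau> i (A $$ (i, j) * g)" "\<lambda>_. 0" g] by simp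
  qed
  have image: "(\<Sum>i<k. \<tau> i (v $ i)) = 0" if v: "v \<in> mat_image A" for v
  proof -
    obtain x where x: "x \<in> carrier_vec n" "v = A *\<^sub>v x" using v A by (auto simp: mat_image_def)
    have "(\<Sum>i<k. \<tau> i (v $ i)) = (\<Sum>i<k. \<Sum>j<n. \<tau> i (A $$ (i, j) * x $ j))"
    proof (intro sum.cong refl)
      fix i assume "i \<in> {..<k}"
      hence "v $ i = (\<Sum>j<n. A $$ (i, j) * x $ j)"
        using x A by (simp add: scalar_prod_def atLeast0LessThan)
      thus "\<tau> i (v $ i) = (\<Sum>j<n. \<tau> i (A $$ (i, j) * x $ j))" by (simp add: additive.sum[OF add_\<tau>])
    qed
    also have "\<dots> = (\<Sum>j<n. \<Sum>i<k. \<tau> i (A $$ (i, j) * x $ j))" by (rule sum.swap)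
    also have "\<dots> = 0" by (simp add: column)
    finally show ?thesis .
  qed
  have \<tau>_zero: "\<tau> i g = 0" if i: "i < k" for i g
  proof (rule bounded_additive_eq_0)
    let ?F = "(\<lambda>J. Determinant.det (submatrix A UNIV J)) ` {J. J \<subseteq> {..<n} \<and> card J = k}"
    show "additive (\<tau> i)" by (rule add_\<tau>)
    show "\<bar>\<tau> i (umonom m)\<bar> \<le> \<eta>" for m by (rule \<tau>_small[OF i])
    show "finite ?F" by (rule finite_imageI, rule finite_subset[of _ "Pow {..<n}"]) auto
    show "\<exists>f\<in>?F. laurent_eval f z \<noteq> 0" if "z \<in> unit_torus" for z using nz[OF that] by auto
    fix f g assume "f \<in> ?F"
    then obtain J where J: "J \<subseteq> {..<n}" "card J = k" "f = Determinant.det (submatrix A UNIV J)" by auto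
    have "f \<cdot>\<^sub>v (g \<cdot>\<^sub>v unit_vec k i) \<in> mat_image A"
      unfolding J(3) by (rule det_smult_in_mat_image[OF A J(1,2)]) simp
    from image[OF this] have "(\<Sum>l<k. \<tau> l ((f \<cdot>\<^sub>v (g \<cdot>\<^sub>v unit_vec k i)) $ l)) = 0" .
    also have "(\<Sum>l<k. \<tau> l ((f \<cdot>\<^sub>v (g \<cdot>\<^sub>v unit_vec k i)) $ l)) = (\<Sum>l<k. if l = i then \<tau> i (f * g) else 0)"
      by (intro sum.cong refl) (use i in \<open>auto simp: additive.zero[OF add_\<tau>]\<close>)
    also have "\<dots> = \<tau> i (f * g)" using i by simp
    finally show "\<tau> i (f * g) = 0" .
  qed
  show ?thesis
  proof (rule one_dual_coker(1)[OF A \<phi>])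
    fix v :: "'d laurent Matrix.vec" assume "v \<in> carrier_vec k"
    thus "\<phi> (coker_class A v) = 1" using \<chi>_eq[of v] by (simp add: \<tau>_zero \<chi>_def)
  qed
qed

text \<open>
  The expansive neighbourhood consists of the characters near \<open>1\<close> on the classes of the unit vectors.
  A character lies in all translates of this neighbourhood exactly when it is near \<open>1\<close> on all monomial multiples of
  unit vectors.
\<close>

lemma expansive_if_minors_nonvanishing:
  fixes A :: "'d::{finite,linorder} laurent mat"
  assumes A: "A \<in> carrier_mat k n"
    and nz: "\<And>z. z \<in> unit_torus \<Longrightarrow> \<exists>J. J \<subseteq> {..<n} \<and> card J = k \<and>
      laurent_eval (Determinant.det (submatrix A UNIV J)) z \<noteq> 0"
  shows "expansive (dual_topology (coker_module A)) (dual_group (coker_module A))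
      (dual_action (coker_module A))"
proof -
  let ?Q = "coker_module A"
  define K where "K = real_of_int (\<Sum>i<k. \<Sum>j<n. coeff_norm (A $$ (i, j)))"
  have "K \<ge> 0" unfolding K_def of_int_0_le_iff by (intro sum_nonneg coeff_norm_nonneg)
  define \<eta> where "\<eta> = 1 / (1 + K)"
  have \<eta>: "\<eta> > 0" "\<eta> * K \<le> 1" using \<open>K \<ge> 0\<close> by (simp_all add: \<eta>_def field_simps)
  obtain \<delta> where \<delta>: "\<delta> > 0" "\<And>z. norm (z - 1) < \<delta> \<Longrightarrow> \<bar>Arg z\<bar> < \<eta>"
    using nbhd_Arg_small[OF \<eta>(1)] by blast
  define U where "U = {\<phi> \<in> carrier (dual_group ?Q). \<forall>i<k. norm (\<phi> (coker_class A (unit_vec k i)) - 1) < \<delta>}"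
  have openU: "openin (dual_topology ?Q) U" unfolding U_def by (rule openin_character_near_one[OF A])
  interpret D: comm_group "dual_group ?Q"
    by (rule comm_group_dual_group) (use module_coker_module in \<open>auto simp: Module.module_def\<close>)
  have oneU: "\<one>\<^bsub>dual_group ?Q\<^esub> \<in> U"
    unfolding U_def using \<delta>(1) by (simp add: one_dual_coker(2)[OF A])
  \<comment> \<open>The identity lies in every translate of \<open>U\<close> because the action fixes it.\<close>
  have one_fixed: "dual_action ?Q m \<one>\<^bsub>dual_group ?Q\<^esub> = \<one>\<^bsub>dual_group ?Q\<^esub>" for m
    by (rule one_dual_coker(1)[OF A dual_action_closed[OF D.one_closed]])
      (simp add: dual_action_coker_class[OF A] one_dual_coker(2)[OF A])
  have "(\<Inter>m. dual_action ?Q m ` U) = {\<one>\<^bsub>dual_group ?Q\<^esub>}"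
  proof (intro equalityI subsetI)
    fix \<phi> assume "\<phi> \<in> {\<one>\<^bsub>dual_group ?Q\<^esub>}"
    thus "\<phi> \<in> (\<Inter>m. dual_action ?Q m ` U)"
      using oneU one_fixed by (auto intro!: image_eqI[of _ _ "\<one>\<^bsub>dual_group ?Q\<^esub>"])
  next
    fix \<phi> assume \<phi>: "\<phi> \<in> (\<Inter>m. dual_action ?Q m ` U)"
    have shift: "dual_action ?Q m \<phi> \<in> U" for m
    proof -
      obtain \<psi> where \<psi>: "\<psi> \<in> U" "\<phi> = dual_action ?Q (- m) \<psi>" using \<phi> by blast
      thus ?thesis using dual_action_cancel[of \<psi> A m] by (simp add: U_def)
    qed
    have \<phi>_car: "\<phi> \<in> carrier (dual_group ?Q)"
    proof -
      obtain \<psi> where "\<psi> \<in> U" "\<phi> = dual_action ?Q 0 \<psi>" using \<phi> by blast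
      thus ?thesis by (simp add: U_def dual_action_closed)
    qed
    have "\<phi> = \<one>\<^bsub>dual_group ?Q\<^esub>"
    proof (rule character_eq_1_if_small[OF A \<phi>_car \<eta>(1) \<eta>(2)[unfolded K_def] _ nz])
      fix i m assume i: "i < k"
      have "norm (dual_action ?Q m \<phi> (coker_class A (unit_vec k i)) - 1) < \<delta>"
        using shift[of m] i by (simp add: U_def)
      thus "\<bar>Arg (\<phi> (coker_class A (umonom m \<cdot>\<^sub>v unit_vec k i)))\<bar> < \<eta>"
        by (intro \<delta>(2)) (simp add: dual_action_coker_class[OF A])
    qed
    thus "\<phi> \<in> {\<one>\<^bsub>dual_group ?Q\<^esub>}" by simp
  qed
  thus ?thesis unfolding expansive_def
    using openU oneU openin_subset[OF openU] by blast
qed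


section \<open>The criterion\<close>

theorem theorem4p2:
  fixes A :: "('d::{finite,linorder}) laurent mat" and k n :: nat
  assumes "A \<in> carrier_mat k n"
    and "vec_space.rank k (map_mat to_fract A) = k"
  shows "expansive (dual_topology (coker_module A)) (dual_group (coker_module A))
      (dual_action (coker_module A))
    \<longleftrightarrow>
    unit_torus \<inter> (\<Inter>J\<in>{J. J \<subseteq> {..<n} \<and> card J = k}.
      zero_locus (Determinant.det (submatrix A UNIV J))) = {}"
    (is "?expansive \<longleftrightarrow> ?common_zeros = {}")
proof
  assume exp: ?expansive
  show "?common_zeros = {}"
  proof (rule ccontr)
    assume "?common_zeros \<noteq> {}"
    then obtain z where z: "z \<in> unit_torus"
      "\<And>J. J \<subseteq> {..<n} \<Longrightarrow> card J = k \<Longrightarrow> laurent_eval (Determinant.det (submatrix A UNIV J)) z = 0"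
      by (auto simp: zero_locus_def)
    interpret ev: comm_ring_hom "\<lambda>f. laurent_eval f z" by (rule comm_ring_hom_eval[OF z(1)])
    define C where "C = map_mat (\<lambda>f. laurent_eval f z) A"
    have C: "C \<in> carrier_mat k n" using assms(1) by (simp add: C_def)
    have "Determinant.det (submatrix C UNIV J) = 0" if "J \<subseteq> {..<n}" "card J = k" for J
      unfolding C_def submatrix_map_mat ev.hom_det using z(2)[OF that] .
    then obtain w i0 where w: "i0 < k" "w i0 \<noteq> 0" "\<And>j. j < n \<Longrightarrow> (\<Sum>i<k. w i * C $$ (i, j)) = 0"
      using minor_zero_left_null_vector[OF C] by metis
    have "(\<Sum>i<k. w i * laurent_eval (A $$ (i, j)) z) = 0" if "j < n" for j
      using w(3)[OF that] that assms(1) by (simp add: C_def)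
    from not_expansive_if_left_null[OF assms(1) z(1) w(1,2) this] exp show False by blast
  qed
next
  assume no_zero: "?common_zeros = {}"
  show ?expansive
  proof (rule expansive_if_minors_nonvanishing[OF assms(1)])
    fix z :: "'d \<Rightarrow> complex" assume z: "z \<in> unit_torus"
    have "z i \<noteq> 0" for i using unit_torus_nz[OF z] .
    with z no_zero show "\<exists>J. J \<subseteq> {..<n} \<and> card J = k \<and> laurent_eval (Determinant.det (submatrix A UNIV J)) z \<noteq> 0"
      unfolding zero_locus_def by blast
  qed
qed

end
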